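(* For $s>0$, the following are equivalent: (a) $\kappa_0\le s$. (b) For all sufficiently large integers $M$, $E_{\mathcal G}\left[E_\omega^0\left[N_0^{[-M,0]}\right]^s\right]=\infty$. (c) For some integer $M\ge0$, $E_{\mathcal G}\left[E_\omega^0\left[N_0^{[-M,M]}\right]^s\right]=\infty$.
   Context: Dirichlet model. Let $L,R$ be positive integers and let $(\alpha_i)_{i=-L}^R$ be non-negative real numbers with $\alpha_{-L}>0$ and $\alpha_R>0$, such that the gcd of all $i$ with $\alpha_i>0$ is $1$. An environment on $\mathbb Z$ is a function $\omega:\mathbb Z\times\mathbb Z\to[0,1]$ with $\sum_{y}\omega(x,y)=1$ for all $x$. $P_\omega^x$ (expectation $E_\omega^x$) is the law of the Markov chain $(X_n)_{n\ge 0}$ on $\mathbb Z$ with $X_0=x$ and transition probabilities $\omega$. $P_{\mathcal G}$ (expectation $E_{\mathcal G}$) is the probability measure on environments under which the transition probability vectors at different sites are independent and, for each $x$, $(\omega(x,x+i))_{-L\le i\le R,\ \alpha_i>0}$ has the Dirichlet distribution with parameters $(\alpha_i)_{\alpha_i>0}$ (all other transition probabilities at $x$ being $0$). $\mathcal G$ is the weighted directed graph with vertex set $\mathbb Z$, an edge from $x$ to $y$ whenever $-L\le y-x\le R$ and $\alpha_{y-x}>0$, with weight $\alpha_{y-x}$. A nonempty set $S\subset\mathbb Z$ is strongly connected if for all $x,y\in S$ there is a path in $\mathcal G$ with at least one edge from $x$ to $y$ using only vertices in $S$ (so a singleton is strongly connected iff $\alpha_0>0$). $\beta_S$ is the sum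 of the weights of all edges of $\mathcal G$ from a vertex in $S$ to a vertex not in $S$. $\kappa_0:=\inf\{\beta_S: S\subset\mathbb Z\text{ finite, strongly connected}\}$. Intervals denote sets of integers. For $S\subseteq\mathbb Z$ and $x\in S$, $N_x^S$ is the number of times $n\ge0$ with $X_n=x$ before the walk leaves $S$ for the first time. $E_\omega^0[N]^s$ means $(E_\omega^0[N])^s$. *)

theory Defs
  imports "HOL-Probability.Probability"
begin

section \<open>The weighted digraph and \<open>\<kappa>\<^sub>0\<close>\<close>

definition steps :: "int \<Rightarrow> int \<Rightarrow> (int \<Rightarrow> real) \<Rightarrow> int set" where
  "steps L R \<alpha> = {i \<in> {-L..R}. \<alpha> i > 0}"

definition edges :: "int \<Rightarrow> int \<Rightarrow> (int \<Rightarrow> real) \<Rightarrow> (int \<times> int) set" where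
  "edges L R \<alpha> = {(x, y). y - x \<in> steps L R \<alpha>}"

text \<open>The transitive closure is not reflexive, so paths have at least one edge.\<close>

definition strongly_conn :: "('a \<times> 'a) set \<Rightarrow> 'a set \<Rightarrow> bool" where
  "strongly_conn E S \<longleftrightarrow> S \<noteq> {} \<and> (\<forall>x\<in>S. \<forall>y\<in>S. (x, y) \<in> (E \<inter> S \<times> S)\<^sup>+)"

definition exit_weight :: "int \<Rightarrow> int \<Rightarrow> (int \<Rightarrow> real) \<Rightarrow> int set \<Rightarrow> real" where
  "exit_weight L R \<alpha> S =
     (\<Sum>(x, y) \<in> {(x, y) \<in> edges L R \<alpha>. x \<in> S \<and> y \<notin> S}. \<alpha> (y - x))"

definition kappa0 :: "int \<Rightarrow> int \<Rightarrow> (int \<Rightarrow> real) \<Rightarrow> ereal" where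
  "kappa0 L R \<alpha> =
     (INF S \<in> {S. finite S \<and> strongly_conn (edges L R \<alpha>) S}. ereal (exit_weight L R \<alpha> S))"


section \<open>Dirichlet distribution and Dirichlet environment\<close>

text \<open>
  The simplex of probability vectors on a finite set \<open>I\<close> is parametrised by the coordinates
  other than a pivot \<open>j \<in> I\<close>. The Dirichlet distribution has its usual density with respect
  to Lebesgue measure in these coordinates; it does not depend on the choice of \<open>j\<close>.
\<close>

definition simplex_point :: "'i set \<Rightarrow> 'i \<Rightarrow> ('i \<Rightarrow> real) \<Rightarrow> 'i \<Rightarrow> real" where
  "simplex_point I j p = (\<lambda>i\<in>I. if i = j then 1 - (\<Sum>k\<in>I - {j}. p k) else p i)"

definition dirichlet_density :: "'i set \<Rightarrow> ('i \<Rightarrow> real) \<Rightarrow> ('i \<Rightarrow> real) \<Rightarrow> real" where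
  "dirichlet_density I a q =
     (if \<forall>i\<in>I. q i > 0
      then Gamma (\<Sum>i\<in>I. a i) / (\<Prod>i\<in>I. Gamma (a i)) * (\<Prod>i\<in>I. q i powr (a i - 1))
      else 0)"

definition dirichlet :: "'i set \<Rightarrow> 'i \<Rightarrow> ('i \<Rightarrow> real) \<Rightarrow> ('i \<Rightarrow> real) measure" where
  "dirichlet I j a =
     distr
       (density (\<Pi>\<^sub>M i\<in>I - {j}. lborel)
          (\<lambda>p. ennreal (dirichlet_density I a (simplex_point I j p))))
       (\<Pi>\<^sub>M i\<in>I. borel)
       (simplex_point I j)"

text \<open>
  The law \<open>P\<^sub>G\<close> of the environment; \<open>\<omega> x y\<close> is the transition probability from \<open>x\<close> to \<open>y\<close>.
  The measure lives on all real arrays \<open>\<omega>\<close> but is concentrated on arrays whose rows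
  are probability vectors.
\<close>

definition dirichlet_env :: "int \<Rightarrow> int \<Rightarrow> (int \<Rightarrow> real) \<Rightarrow> (int \<Rightarrow> int \<Rightarrow> real) measure" where
  "dirichlet_env L R \<alpha> =
     distr
       (\<Pi>\<^sub>M x\<in>UNIV. dirichlet (steps L R \<alpha>) R \<alpha>)
       (\<Pi>\<^sub>M x\<in>UNIV. \<Pi>\<^sub>M y\<in>UNIV. borel)
       (\<lambda>v x y. if y - x \<in> steps L R \<alpha> then v x (y - x) else 0)"


section \<open>Random walk in a fixed environment\<close>

definition chain_step :: "('a \<Rightarrow> 'a pmf) \<Rightarrow> 'a \<Rightarrow> nat \<Rightarrow> (nat \<Rightarrow> 'a) \<Rightarrow> 'a measure" where
  "chain_step K x n h =
     (case n of 0 \<Rightarrow> return (count_space UNIV) x | Suc m \<Rightarrow> measure_pmf (K (h m)))"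

lemma Ionescu_Tulcea_chain_step: "Ionescu_Tulcea (chain_step K x) (\<lambda>_. count_space UNIV)"
proof (rule Ionescu_Tulcea.intro)
  fix i
  show "chain_step K x i \<in> measurable (\<Pi>\<^sub>M i\<in>{0..<i}. count_space UNIV)
          (subprob_algebra (count_space UNIV))"
  proof (cases i)
    case 0
    then show ?thesis
      by (auto simp: chain_step_def[abs_def] space_subprob_algebra
            intro!: measurable_const prob_space_imp_subprob_space prob_space_return)
  next
    case (Suc m)
    have "(\<lambda>y. measure_pmf (K y)) \<in> measurable (count_space UNIV) (subprob_algebra (count_space UNIV))"
      by (auto simp: space_subprob_algebra intro: measure_pmf.subprob_space_axioms)
    moreover have "(\<lambda>h. h m) \<in> measurable (\<Pi>\<^sub>M i\<in>{0..<i}. count_space UNIV) (count_space UNIV)"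
      using Suc by (intro measurable_component_singleton) auto
    ultimately show ?thesis
      using Suc by (auto simp: chain_step_def[abs_def] intro: measurable_compose)
  qed
next
  fix i and h :: "nat \<Rightarrow> 'a"
  show "prob_space (chain_step K x i h)"
    by (cases i)
       (auto simp: chain_step_def intro: prob_space_return measure_pmf.prob_space_axioms)
qed

text \<open>
  The law on trajectories of the Markov chain with kernel \<open>K\<close> started at \<open>x\<close>, as the
  projective limit provided by the Ionescu-Tulcea theorem; \<open>chain_law_cylinder\<close> below
  characterises it.
\<close>

definition chain_law :: "('a \<Rightarrow> 'a pmf) \<Rightarrow> 'a \<Rightarrow> (nat \<Rightarrow> 'a) measure" where
  "chain_law K x =
     projective_family.lim UNIV (Ionescu_Tulcea.CI (chain_step K x) (\<lambda>_. count_space UNIV))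
       (\<lambda>_. count_space UNIV)"

lemma sets_chain_law: "sets (chain_law K x) = sets (\<Pi>\<^sub>M n\<in>UNIV. count_space UNIV)"
proof -
  interpret IT: Ionescu_Tulcea "chain_step K x" "\<lambda>_. count_space UNIV"
    by (rule Ionescu_Tulcea_chain_step)
  show ?thesis
    unfolding chain_law_def by simp
qed

lemma chain_law_cylinder:
  "emeasure (chain_law K x) {X. \<forall>i\<le>n. X i = a i} =
     ennreal (if a 0 = x then \<Prod>i<n. pmf (K (a i)) (a (Suc i)) else 0)"
proof -
  let ?M = "\<lambda>_::nat. count_space (UNIV :: 'a set)"
  interpret IT: Ionescu_Tulcea "chain_step K x" ?M
    by (rule Ionescu_Tulcea_chain_step)
  define A where "A n = {restrict a {0..<n}}" for n
  have A_eq: "A n = PiE {0..<n} (\<lambda>i. {a i})" for n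
    unfolding A_def by (auto simp: PiE_def Pi_def extensional_def restrict_def fun_eq_iff)
  have A_sets: "A n \<in> sets (PiM {0..<n} ?M)" for n
    unfolding A_eq by (intro sets_PiM_I_finite) auto
  have C: "emeasure (IT.C 0 (Suc n) (\<lambda>_. undefined)) (A (Suc n)) =
     ennreal (if a 0 = x then \<Prod>i<n. pmf (K (a i)) (a (Suc i)) else 0)" for n
  proof (induction n)
    case 0
    have u: "(\<lambda>_. undefined) \<in> space (PiM {0..<0} ?M)"
      by simp
    have "IT.C 0 (Suc 0) (\<lambda>_. undefined) = IT.eP 0 (\<lambda>_. undefined)"
      using bind_return[OF IT.measurable_eP[of 0] u] by simp
    moreover have "emeasure (IT.eP 0 (\<lambda>_. undefined)) (A (Suc 0)) = indicator {a 0} x"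
    proof -
      have vim: "(\<lambda>y. (\<lambda>_. undefined)(0 := y)) -` A (Suc 0) = {a 0}"
      proof -
        have "(\<lambda>_. undefined)(0 := y) = restrict a {0..<Suc 0} \<longleftrightarrow> y = a 0" for y
        proof
          assume eq: "(\<lambda>_. undefined)(0 := y) = restrict a {0..<Suc 0}"
          show "y = a 0"
            using fun_cong[OF eq, of 0] by simp
        qed (simp add: fun_eq_iff)
        then show ?thesis
          by (intro set_eqI) (simp only: A_def vimage_eq singleton_iff)
      qed
      show ?thesis
        by (subst IT.emeasure_eP[OF u A_sets]) (auto simp: vim chain_step_def)
    qed
    ultimately show ?case
      by (auto simp: indicator_def)
  next
    case (Suc n)
    let ?u = "\<lambda>_. undefined"
    let ?p = "pmf (K (a n)) (a (Suc n))"
    have u: "?u \<in> space (PiM {0..<0} ?M)"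
      by simp
    have sp: "space (IT.C 0 (Suc n) ?u) = space (PiM {0..<Suc n} ?M)"
      using IT.space_C[OF u, of "Suc n"] by simp
    have st: "sets (IT.C 0 (Suc n) ?u) = sets (PiM {0..<Suc n} ?M)"
      using IT.sets_C[OF u, of "Suc n"] by simp
    have eP: "emeasure (IT.eP (Suc n) h) (A (Suc (Suc n))) = ennreal ?p * indicator (A (Suc n)) h"
      if h: "h \<in> space (PiM {0..<Suc n} ?M)" for h
    proof -
      have ext: "h i = undefined" if "i > n" for i
        using h that by (auto simp: space_PiM PiE_def extensional_def)
      have "(\<lambda>y. h(Suc n := y)) -` A (Suc (Suc n)) =
            (if h \<in> A (Suc n) then {a (Suc n)} else {})"
      proof -
        have "h(Suc n := y) = restrict a {0..<Suc (Suc n)} \<longleftrightarrow>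
              y = a (Suc n) \<and> h = restrict a {0..<Suc n}" for y
        proof
          assume eq: "h(Suc n := y) = restrict a {0..<Suc (Suc n)}"
          have "y = a (Suc n)"
            using fun_cong[OF eq, of "Suc n"] by simp
          moreover have "h i = restrict a {0..<Suc n} i" for i
            using fun_cong[OF eq, of i] ext[of i]
            by (cases "i \<le> n") (auto simp: restrict_def split: if_splits)
          ultimately show "y = a (Suc n) \<and> h = restrict a {0..<Suc n}"
            by auto
        qed (auto simp: fun_eq_iff restrict_def)
        then show ?thesis
          by (intro set_eqI) (simp only: A_def vimage_eq singleton_iff, simp)
      qed
      then have "emeasure (IT.eP (Suc n) h) (A (Suc (Suc n))) =
          emeasure (measure_pmf (K (h n))) (if h \<in> A (Suc n) then {a (Suc n)} else {})"
        by (subst IT.emeasure_eP[OF h A_sets]) (simp add: chain_step_def)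
      also have "\<dots> = ennreal ?p * indicator (A (Suc n)) h"
        by (auto simp: emeasure_pmf_single A_def)
      finally show ?thesis .
    qed
    have "emeasure (IT.C 0 (Suc (Suc n)) ?u) (A (Suc (Suc n))) =
       (\<integral>\<^sup>+h. emeasure (IT.eP (Suc n) h) (A (Suc (Suc n))) \<partial>IT.C 0 (Suc n) ?u)"
      unfolding IT.C.simps(2)[of 0 "Suc n"]
    proof (subst emeasure_bind[OF _ _ A_sets])
      show "space (IT.C 0 (Suc n) ?u) \<noteq> {}"
        unfolding sp by (auto simp: space_PiM PiE_eq_empty_iff)
      show "IT.eP (0 + Suc n) \<in> measurable (IT.C 0 (Suc n) ?u)
              (subprob_algebra (PiM {0..<Suc (Suc n)} ?M))"
        using IT.measurable_eP[of "Suc n"]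
        by (simp add: measurable_cong_sets[OF st refl] del: IT.C.simps)
    qed simp
    also have "\<dots> = (\<integral>\<^sup>+h. ennreal ?p * indicator (A (Suc n)) h \<partial>IT.C 0 (Suc n) ?u)"
      by (intro nn_integral_cong eP) (simp only: sp)
    also have "\<dots> = ennreal ?p * emeasure (IT.C 0 (Suc n) ?u) (A (Suc n))"
      by (rule nn_integral_cmult_indicator) (simp only: st A_sets)
    finally show ?case
      unfolding Suc by (simp add: ennreal_mult[symmetric] prod_nonneg mult.commute)
  qed
  have emb: "prod_emb UNIV ?M {0..<Suc n} (A (Suc n)) = {X. \<forall>i\<le>n. X i = a i}"
    unfolding A_eq prod_emb_def by (auto simp: space_PiM restrict_PiE_iff Pi_iff less_Suc_eq_le)
  have "emeasure (chain_law K x) {X. \<forall>i\<le>n. X i = a i} = emeasure (IT.CI {0..<Suc n}) (A (Suc n))"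
    unfolding chain_law_def emb[symmetric] by (rule IT.lim) (auto simp: A_sets)
  also have "\<dots> = emeasure (IT.C 0 (Suc n) (\<lambda>_. undefined)) (A (Suc n))"
    using IT.emeasure_CI[of "{0..<Suc n}" "Suc n" "A (Suc n)"] A_sets
    using prod_emb_id[of "A (Suc n)" "{0..<Suc n}" ?M] sets.sets_into_space[OF A_sets, of "Suc n"]
    by (simp add: space_PiM del: IT.C.simps)
  finally show ?thesis
    using C by simp
qed

text \<open>\<open>P\<^sub>\<omega>\<^sup>x\<close>; the conversion to probability mass functions is faithful on rows of \<open>\<omega>\<close> that are
  probability vectors.\<close>

definition walk :: "(int \<Rightarrow> int \<Rightarrow> real) \<Rightarrow> int \<Rightarrow> (nat \<Rightarrow> int) measure" where
  "walk \<omega> x = chain_law (\<lambda>y. embed_pmf (\<omega> y)) x"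

text \<open>Cardinality as an extended number: a walk that never leaves \<open>S\<close> may visit \<open>x\<close> infinitely often.\<close>

definition visits :: "'a set \<Rightarrow> 'a \<Rightarrow> (nat \<Rightarrow> 'a) \<Rightarrow> ennreal" where
  "visits S x X = emeasure (count_space UNIV) {n. X n = x \<and> (\<forall>k\<le>n. X k \<in> S)}"

definition ennreal_powr :: "ennreal \<Rightarrow> real \<Rightarrow> ennreal" where
  "ennreal_powr t s = (if t = \<infinity> then \<infinity> else ennreal (enn2real t powr s))"

text \<open>\<open>E\<^sub>G[E\<^sub>\<omega>\<^sup>0[N\<^sub>0\<^sup>S]\<^sup>s]\<close>, meant for \<open>s > 0\<close>.\<close>

definition annealed_moment :: "int \<Rightarrow> int \<Rightarrow> (int \<Rightarrow> real) \<Rightarrow> int set \<Rightarrow> real \<Rightarrow> ennreal" where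
  "annealed_moment L R \<alpha> S s =
     (\<integral>\<^sup>+\<omega>. ennreal_powr (\<integral>\<^sup>+X. visits S 0 X \<partial>walk \<omega> 0) s \<partial>dirichlet_env L R \<alpha>)"

end

theory Submission
  imports Defs
begin

text \<open>
  Fix an environment \<open>\<omega>\<close> and let \<open>G(x)\<close> be the expected number of visits to \<open>x\<close> of the walk started at \<open>0\<close> and
  killed when it leaves a finite set \<open>S\<close> of sites. The only property of \<open>G\<close> that matters is the one-step inequality
  \<open>G(x) * \<omega>(x,y) \<le> G(y)\<close>, together with conservation of mass at the exits. Both nontrivial implications compare
  \<open>G(0)\<close> with the transition probabilities along the edges that leave a set, and the independent Dirichlet
  rows turn such comparisons into powers governed by exit weights.

  From a trap to infinite moments. The weights \<open>\<alpha>\<close> take finitely many positive values, so the exit weights below a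
  given bound form a finite set and the infimum \<open>\<kappa>\<^sub>0\<close> is attained (\<open>kappa0_attained\<close>): if \<open>\<kappa>\<^sub>0 \<le> s\<close>, some finite
  strongly connected \<open>S\<close> has exit weight at most \<open>s\<close>, and it may be translated so that its maximum is \<open>0\<close>. With
  probability at least a constant times \<open>t powr \<beta>\<^sub>S\<close>, all exits of \<open>S\<close> have transition probability at most \<open>t\<close> while
  the edges inside \<open>S\<close> keep probabilities bounded below (\<open>dirichlet_box\<close>). The walk then needs a time of
  order \<open>1/t\<close> to leave \<open>S\<close>, and by strong connectedness a fixed fraction of this time is spent at \<open>0\<close>, so
  \<open>G(0) \<ge> D/t\<close>. Hence \<open>y * P(G(0) powr s \<ge> y)\<close> stays bounded away from \<open>0\<close> along values \<open>y\<close> that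
  tend to infinity, which is impossible for a variable with finite mean (\<open>annealed_moment_infinite\<close>).

  From heavy exits to finite moments. Suppose that every finite strongly connected set has exit weight at least
  \<open>\<kappa>\<close>, where \<open>\<kappa> > s\<close>. Consider the level sets \<open>B\<^sub>t = {x. G(x) \<ge> exp (-t) * G(0)}\<close> for \<open>0 \<le> t < ln (G(0))\<close>. At each site some
  step has probability at least one over the number of steps, so except for \<open>t\<close> in a set of bounded length
  \<open>B\<^sub>t\<close> contains the endpoint of a likely step from each of its points. Such a set contains a strongly connected
  class that can only be left together with \<open>B\<^sub>t\<close>, so its exit weight is at least \<open>\<kappa>\<close>. An edge \<open>(x,y)\<close> leaves
  \<open>B\<^sub>t\<close> for \<open>t\<close> in an interval of length at most \<open>- ln (\<omega>(x,y))\<close>; integrating over \<open>t\<close> gives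
  \<open>\<kappa> * ln (G(0)) \<le> const + (\<Sum>(x,y). \<alpha>(y-x) * (- ln (\<omega>(x,y))))\<close> (\<open>coarea_bound\<close>). So \<open>G(0) powr s\<close> is at most a constant
  times a product of powers \<open>\<omega>(x,y) powr (- s / \<kappa> * \<alpha>(y-x))\<close>, whose expectation is a product of Dirichlet
  moments; these are finite because \<open>s / \<kappa> < 1\<close> (\<open>annealed_moment_finite\<close>).

  The remaining implications are monotonicity of the number of visits in \<open>S\<close>.
\<close>


section \<open>The Dirichlet distribution\<close>

lemma Beta_real_nonneg: "a > 0 \<Longrightarrow> b > 0 \<Longrightarrow> Beta a b \<ge> (0::real)"
  unfolding Beta_def
  by (intro divide_nonneg_nonneg mult_nonneg_nonneg less_imp_le Gamma_real_pos add_pos_pos)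

lemma nn_integral_Beta_scaled:
  fixes a b w :: real
  assumes "a > 0" "b > 0" "w > 0"
  shows "(\<integral>\<^sup>+t. ennreal (if 0 < t \<and> t < w then t powr (a - 1) * (w - t) powr (b - 1) else 0) \<partial>lborel)
    = ennreal (w powr (a + b - 1) * Beta a b)"
proof -
  let ?f = "\<lambda>t::real. if 0 < t \<and> t < 1 then t powr (a - 1) * (1 - t) powr (b - 1) else 0"
  let ?g = "\<lambda>t. if 0 < t \<and> t < w then t powr (a - 1) * (w - t) powr (b - 1) else 0"
  have "((\<lambda>t. t powr (a - 1) * (1 - t) powr (b - 1)) has_integral Beta a b) {0..1}"
    using assms by (intro has_integral_Beta_real)
  then have "((\<lambda>t. if t \<in> {0..1} then t powr (a - 1) * (1 - t) powr (b - 1) else 0) has_integral Beta a b) UNIV"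
    by (simp only: has_integral_restrict_UNIV)
  moreover have "(\<lambda>t. if t \<in> {0..1} then t powr (a - 1) * (1 - t) powr (b - 1) else 0) = ?f"
    by (auto simp: fun_eq_iff not_less)
  ultimately have hi: "(?f has_integral Beta a b) UNIV" by simp
  have mf: "?f \<in> borel_measurable borel" by measurable
  have int: "(\<integral>\<^sup>+t. ennreal (?f t) \<partial>lborel) = ennreal (Beta a b)"
    by (rule nn_integral_has_integral_lborel[OF mf _ hi]) auto
  have scale: "?g (w * t) = w powr (a + b - 2) * ?f t" for t
  proof -
    have "(w * t) powr (a - 1) * (w - w * t) powr (b - 1)
       = w powr (a + b - 2) * (t powr (a - 1) * (1 - t) powr (b - 1))" if "0 < t" "t < 1"
    proof -
      have "w - w * t = w * (1 - t)" by (simp add: algebra_simps)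
      moreover have "w powr (a + b - 2) = w powr (a - 1) * w powr (b - 1)"
        by (simp add: powr_add[symmetric])
      ultimately show ?thesis using that assms by (simp add: powr_mult)
    qed
    then show ?thesis using assms by (auto simp: zero_less_mult_iff)
  qed
  have "(\<integral>\<^sup>+t. ennreal (?g t) \<partial>lborel) = ennreal \<bar>w\<bar> * (\<integral>\<^sup>+t. ennreal (?g (0 + w * t)) \<partial>lborel)"
    using assms by (intro nn_integral_real_affine) auto
  also have "\<dots> = ennreal w * (\<integral>\<^sup>+t. ennreal (w powr (a + b - 2)) * ennreal (?f t) \<partial>lborel)"
    using assms by (simp only: scale add_0 ennreal_mult' [OF powr_ge_zero] abs_of_pos)
  also have "\<dots> = ennreal w * (ennreal (w powr (a + b - 2)) * ennreal (Beta a b))"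
    by (subst nn_integral_cmult) (use int in auto)
  also have "\<dots> = ennreal (w powr (a + b - 1) * Beta a b)"
  proof -
    have "w * w powr (a + b - 2) = w powr (a + b - 1)"
      using assms powr_add[of w 1 "a + b - 2"] by simp
    moreover have "Beta a b \<ge> 0" using assms by (intro Beta_real_nonneg)
    ultimately show ?thesis using assms by (simp add: ennreal_mult'[symmetric] mult.assoc[symmetric])
  qed
  finally show ?thesis .
qed

lemma measurable_prod_powr:
 "finite I \<Longrightarrow> (\<lambda>q. \<Prod>i\<in>I. (q i::real) powr c i) \<in> borel_measurable (\<Pi>\<^sub>M i\<in>I. borel)"
  by measurable

text \<open>
  One coordinate at a time can be integrated out: for fixed values of the others, the inner integral is a Beta
  integral over an interval of length \<open>1 - sum p K\<close>, and it leaves an integrand of the same shape in which the last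
  exponent has grown from \<open>b\<close> to \<open>a k + b\<close>. This is why the induction must generalise over \<open>b\<close>.
\<close>

lemma dirichlet_integral:
  fixes a :: "'i \<Rightarrow> real"
  assumes "finite K" "\<And>k. k \<in> K \<Longrightarrow> a k > 0" "b > 0"
  shows "(\<integral>\<^sup>+p. ennreal (if (\<forall>k\<in>K. p k > 0) \<and> sum p K < 1
            then (\<Prod>k\<in>K. p k powr (a k - 1)) * (1 - sum p K) powr (b - 1) else 0) \<partial>(\<Pi>\<^sub>M k\<in>K. lborel))
    = ennreal ((\<Prod>k\<in>K. Gamma (a k)) * Gamma b / Gamma (sum a K + b))"
  using assms
proof (induction K arbitrary: b rule: finite_induct)
  case empty
  have "Gamma b \<noteq> 0"
    using Gamma_real_pos[OF empty.prems(2)] by (metis less_irrefl)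
  then show ?case
    by (simp add: nn_integral_count_space_finite PiM_empty)
next
  case (insert k K)
  interpret product_sigma_finite "\<lambda>_::'i. lborel :: real measure"
    by standard
  let ?F = "\<lambda>K b p. if (\<forall>k\<in>K. p k > 0) \<and> sum p K < 1
            then (\<Prod>k\<in>K. p k powr (a k - 1)) * (1 - sum p K) powr (b - 1) else 0"
  have "(\<integral>\<^sup>+p. ennreal (?F (insert k K) b p) \<partial>(\<Pi>\<^sub>M k\<in>insert k K. lborel))
    = (\<integral>\<^sup>+p. \<integral>\<^sup>+t. ennreal (?F (insert k K) b (p(k := t))) \<partial>lborel \<partial>(\<Pi>\<^sub>M k\<in>K. lborel))"
    using insert.hyps by (intro product_nn_integral_insert) measurable
  also have "\<dots> = (\<integral>\<^sup>+p. ennreal (Beta (a k) b) * ennreal (?F K (a k + b) p) \<partial>(\<Pi>\<^sub>M k\<in>K. lborel))"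
  proof (intro nn_integral_cong)
    fix p :: "'i \<Rightarrow> real"
    define w where "w = 1 - sum p K"
    define c where "c = (if \<forall>k\<in>K. p k > 0 then \<Prod>k\<in>K. p k powr (a k - 1) else 0)"
    have c0: "c \<ge> 0" by (auto simp: c_def intro!: prod_nonneg)
    have s: "sum (p(k := t)) (insert k K) = t + sum p K" for t
      using insert.hyps by (subst sum.insert) (auto intro!: sum.cong)
    have P: "(\<Prod>i\<in>insert k K. (p(k := t)) i powr (a i - 1)) = t powr (a k - 1) * (\<Prod>i\<in>K. p i powr (a i - 1))" for t
      using insert.hyps by (subst prod.insert) (auto intro!: prod.cong)
    have A: "(\<forall>i\<in>insert k K. (p(k := t)) i > 0) \<longleftrightarrow> t > 0 \<and> (\<forall>i\<in>K. p i > 0)" for t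
      using insert.hyps by auto
    have F: "?F (insert k K) b (p(k := t)) = c * (if 0 < t \<and> t < w then t powr (a k - 1) * (w - t) powr (b - 1) else 0)" for t
      unfolding s P A c_def w_def by (auto simp: algebra_simps)
    have Fr: "?F K (a k + b) p = c * (if w > 0 then w powr (a k + b - 1) else 0)"
      unfolding c_def w_def by auto
    have "(\<integral>\<^sup>+t. ennreal (?F (insert k K) b (p(k := t))) \<partial>lborel) =
      ennreal c * (\<integral>\<^sup>+t. ennreal (if 0 < t \<and> t < w then t powr (a k - 1) * (w - t) powr (b - 1) else 0) \<partial>lborel)"
      unfolding F ennreal_mult'[OF c0] by (rule nn_integral_cmult) simp
    also have "\<dots> = ennreal c * ennreal ((if w > 0 then w powr (a k + b - 1) else 0) * Beta (a k) b)"
    proof (cases "w > 0")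
      case True
      then show ?thesis using insert.prems by (subst nn_integral_Beta_scaled) auto
    next
      case False
      then have z: "(\<lambda>t. ennreal (if 0 < t \<and> t < w then t powr (a k - 1) * (w - t) powr (b - 1) else 0)) = (\<lambda>_. 0)"
        by (auto simp: fun_eq_iff)
      show ?thesis using False by (subst z) simp
    qed
    also have "\<dots> = ennreal (Beta (a k) b) * ennreal (?F K (a k + b) p)"
      unfolding Fr using c0 insert.prems
      by (auto simp: ennreal_mult'[symmetric] ennreal_mult''[symmetric] Beta_def Gamma_real_pos less_imp_le mult_ac)
    finally show "(\<integral>\<^sup>+t. ennreal (?F (insert k K) b (p(k := t))) \<partial>lborel) = \<dots>" .
  qed
  also have "\<dots> = ennreal (Beta (a k) b) * ennreal ((\<Prod>k\<in>K. Gamma (a k)) * Gamma (a k + b) / Gamma (sum a K + (a k + b)))"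
  proof (subst nn_integral_cmult)
    show "(\<lambda>p. ennreal (?F K (a k + b) p)) \<in> borel_measurable (\<Pi>\<^sub>M k\<in>K. lborel)"
      using insert.hyps by measurable
    show "ennreal (Beta (a k) b) * (\<integral>\<^sup>+p. ennreal (?F K (a k + b) p) \<partial>(\<Pi>\<^sub>M k\<in>K. lborel)) =
       ennreal (Beta (a k) b) * ennreal ((\<Prod>k\<in>K. Gamma (a k)) * Gamma (a k + b) / Gamma (sum a K + (a k + b)))"
      using insert.prems by (subst insert.IH) (auto intro: add_pos_pos)
  qed
  also have "\<dots> = ennreal ((\<Prod>k\<in>insert k K. Gamma (a k)) * Gamma b / Gamma (sum a (insert k K) + b))"
  proof -
    have "Gamma (a k + b) > 0" using insert.prems by (intro Gamma_real_pos) (auto intro: add_pos_pos)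
    moreover have "Beta (a k) b \<ge> 0" using insert.prems by (intro Beta_real_nonneg) auto
    ultimately show ?thesis using insert.hyps
      by (simp add: ennreal_mult'[symmetric] Beta_def ac_simps)
  qed
  finally show ?case .
qed

lemma measurable_simplex_point:
  fixes I :: "'i set"
  assumes "finite I"
  shows "simplex_point I j \<in> measurable (\<Pi>\<^sub>M i\<in>I - {j}. lborel) (\<Pi>\<^sub>M i\<in>I. borel)"
  unfolding simplex_point_def
proof (intro measurable_restrict)
  fix i assume "i \<in> I"
  then show "(\<lambda>p. if i = j then 1 - (\<Sum>k\<in>I - {j}. p k) else p i) \<in> borel_measurable (\<Pi>\<^sub>M i\<in>I - {j}. lborel)"
    using assms by (cases "i = j") (auto intro!: borel_measurable_diff borel_measurable_sum)
qed

lemma measurable_dirichlet_density: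
  assumes "finite I"
  shows "dirichlet_density I a \<in> borel_measurable (\<Pi>\<^sub>M i\<in>I. borel)"
proof -
  have "countable I" using assms by (rule countable_finite)
  then show ?thesis using assms unfolding dirichlet_density_def by measurable
qed

lemma sets_dirichlet [measurable_cong, simp]: "sets (dirichlet I j a) = sets (\<Pi>\<^sub>M i\<in>I. borel)"
  by (simp add: dirichlet_def)

lemma space_dirichlet: "space (dirichlet I j a) = space (\<Pi>\<^sub>M i\<in>I. borel)"
  by (simp add: dirichlet_def)

lemma nn_integral_dirichlet:
  assumes "finite I" "f \<in> borel_measurable (\<Pi>\<^sub>M i\<in>I. borel)"
  shows "(\<integral>\<^sup>+q. f q \<partial>dirichlet I j a)
    = (\<integral>\<^sup>+p. ennreal (dirichlet_density I a (simplex_point I j p)) * f (simplex_point I j p) \<partial>(\<Pi>\<^sub>M i\<in>I - {j}. lborel))"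
proof -
  note [measurable] = measurable_simplex_point[OF assms(1), of j] measurable_dirichlet_density[OF assms(1), of a] assms(2)
  have "simplex_point I j \<in> measurable
     (density (\<Pi>\<^sub>M i\<in>I - {j}. lborel) (\<lambda>p. ennreal (dirichlet_density I a (simplex_point I j p)))) (\<Pi>\<^sub>M i\<in>I. borel)"
    by simp
  then show ?thesis unfolding dirichlet_def using assms(2)
    by (simp add: nn_integral_distr nn_integral_density)
qed

text \<open>
  With all coordinates other than the two pivots fixed, passing from one chart of the simplex to the other is the
  reflection \<open>t \<mapsto> (1 - sum p K) - t\<close> of the line, which preserves Lebesgue measure.
\<close>

lemma simplex_point_change_pivot:
  fixes f :: "('i \<Rightarrow> real) \<Rightarrow> ennreal"
  assumes "finite I" "j \<in> I" "j' \<in> I" "f \<in> borel_measurable (\<Pi>\<^sub>M i\<in>I. borel)"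
  shows "(\<integral>\<^sup>+p. f (simplex_point I j p) \<partial>(\<Pi>\<^sub>M i\<in>I - {j}. lborel))
       = (\<integral>\<^sup>+p. f (simplex_point I j' p) \<partial>(\<Pi>\<^sub>M i\<in>I - {j'}. lborel))"
proof (cases "j = j'")
  case False
  interpret product_sigma_finite "\<lambda>_::'i. lborel :: real measure"
    by standard
  define K where "K = I - {j, j'}"
  have K1: "finite K" using assms(1) by (simp add: K_def)
  have K2: "j \<notin> K" "j' \<notin> K" by (simp_all add: K_def)
  have K3: "I - {j} = insert j' K" using assms(2,3) False unfolding K_def by blast
  have K4: "I - {j'} = insert j K" using assms(2,3) False unfolding K_def by blast
  note K = K1 K2 K3 K4
  have meas: "(\<lambda>p. f (simplex_point I i p)) \<in> borel_measurable (\<Pi>\<^sub>M k\<in>I - {i}. lborel)" for i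
    using measurable_compose[OF measurable_simplex_point[OF assms(1)] assms(4)] by simp
  have upd: "sum (p(i := u)) (insert i K) = u + sum p K" if "i \<notin> K" for p :: "'i \<Rightarrow> real" and i u
  proof -
    have "sum (p(i := u)) (insert i K) = (p(i := u)) i + sum (p(i := u)) K"
      using K1 that by (rule sum.insert)
    moreover have "sum (p(i := u)) K = sum p K"
      using that by (intro sum.cong) auto
    ultimately show ?thesis by (simp only: fun_upd_same)
  qed
  have sj: "simplex_point I j (p(j' := u)) = (\<lambda>i\<in>I. if i = j then 1 - (u + sum p K) else (p(j' := u)) i)" for p u
    unfolding simplex_point_def K3 upd[OF K2(2)] ..
  have sj': "simplex_point I j' (p(j := u)) = (\<lambda>i\<in>I. if i = j' then 1 - (u + sum p K) else (p(j := u)) i)" for p u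
    unfolding simplex_point_def K4 upd[OF K2(1)] ..
  have swap: "simplex_point I j (p(j' := (1 - sum p K) + (-1) * t)) = simplex_point I j' (p(j := t))" for p t
    unfolding sj sj' using False by (intro restrict_ext) simp
  have line: "(\<lambda>t. f (simplex_point I j (p(j' := t)))) \<in> borel_measurable borel" if "p \<in> space (\<Pi>\<^sub>M k\<in>K. lborel)" for p
  proof -
    have "(\<lambda>t. p(j' := t)) \<in> measurable lborel (\<Pi>\<^sub>M k\<in>insert j' K. lborel)"
      using that by (intro measurable_fun_upd[where J = K]) auto
    from measurable_compose[OF this[folded K(4)] meas[of j]] show ?thesis by simp
  qed
  have "(\<integral>\<^sup>+p. f (simplex_point I j p) \<partial>(\<Pi>\<^sub>M i\<in>I - {j}. lborel))
     = (\<integral>\<^sup>+p. \<integral>\<^sup>+t. f (simplex_point I j (p(j' := t))) \<partial>lborel \<partial>(\<Pi>\<^sub>M k\<in>K. lborel))"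
    using meas[of j] unfolding K(4) by (intro product_nn_integral_insert K)
  also have "\<dots> = (\<integral>\<^sup>+p. \<integral>\<^sup>+t. f (simplex_point I j' (p(j := t))) \<partial>lborel \<partial>(\<Pi>\<^sub>M k\<in>K. lborel))"
  proof (rule nn_integral_cong)
    fix p :: "'i \<Rightarrow> real" assume "p \<in> space (\<Pi>\<^sub>M k\<in>K. lborel)"
    then show "(\<integral>\<^sup>+t. f (simplex_point I j (p(j' := t))) \<partial>lborel) = (\<integral>\<^sup>+t. f (simplex_point I j' (p(j := t))) \<partial>lborel)"
      by (subst nn_integral_real_affine[OF line, of _ "-1" "1 - sum p K"]) (simp_all only: swap, simp_all)
  qed
  also have "\<dots> = (\<integral>\<^sup>+p. f (simplex_point I j' p) \<partial>(\<Pi>\<^sub>M i\<in>I - {j'}. lborel))"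
    using meas[of j'] unfolding K(5) by (intro product_nn_integral_insert[symmetric] K)
  finally show ?thesis .
qed simp

lemma dirichlet_change_pivot:
  assumes "finite I" "j \<in> I" "j' \<in> I"
  shows "dirichlet I j a = dirichlet I j' a"
proof (rule measure_eqI)
  fix A assume "A \<in> sets (dirichlet I j a)"
  then have A: "A \<in> sets (\<Pi>\<^sub>M i\<in>I. borel)" by simp
  note [measurable] = measurable_dirichlet_density[OF assms(1), of a] A
  have "emeasure (dirichlet I i a) A =
     (\<integral>\<^sup>+p. (\<lambda>q. ennreal (dirichlet_density I a q) * indicator A q) (simplex_point I i p) \<partial>(\<Pi>\<^sub>M i\<in>I - {i}. lborel))" for i
  proof -
    have "emeasure (dirichlet I i a) A = (\<integral>\<^sup>+q. indicator A q \<partial>dirichlet I i a)"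
      using A by simp
    also have "\<dots> = (\<integral>\<^sup>+p. (\<lambda>q. ennreal (dirichlet_density I a q) * indicator A q) (simplex_point I i p) \<partial>(\<Pi>\<^sub>M i\<in>I - {i}. lborel))"
      using A by (intro nn_integral_dirichlet assms(1)) simp
    finally show ?thesis .
  qed
  then show "emeasure (dirichlet I j a) A = emeasure (dirichlet I j' a) A"
    using simplex_point_change_pivot[OF assms, of "\<lambda>q. ennreal (dirichlet_density I a q) * indicator A q"]
    by simp
qed simp

lemma prod_Gamma_pos: "(\<And>i. i \<in> I \<Longrightarrow> (a i::real) > 0) \<Longrightarrow> (\<Prod>i\<in>I. Gamma (a i)) > 0"
  by (auto intro!: prod_pos Gamma_real_pos)

text \<open>
  Multiplying the Dirichlet density by powers of the coordinates gives an unnormalised density of the same type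
  with parameters \<open>a i - c i\<close>. The case \<open>c = 0\<close> is the normalisation of the distribution, and the moment is
  finite as long as \<open>c i < a i\<close> for each \<open>i\<close>.
\<close>

lemma dirichlet_moment:
  assumes "finite I" "j \<in> I" "\<And>i. i \<in> I \<Longrightarrow> c i < a i"
  shows "(\<integral>\<^sup>+q. ennreal (\<Prod>i\<in>I. q i powr (- c i)) \<partial>dirichlet I j a)
    = ennreal (Gamma (sum a I) / (\<Prod>i\<in>I. Gamma (a i))) *
      ennreal ((\<Prod>i\<in>I. Gamma (a i - c i)) / Gamma (\<Sum>i\<in>I. a i - c i))"
proof -
  define K where "K = I - {j}"
  have K: "finite K" "j \<notin> K" "I = insert j K" using assms by (auto simp: K_def)
  let ?C = "Gamma (sum a I) / (\<Prod>i\<in>I. Gamma (a i))"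
  let ?G = "\<lambda>p. if (\<forall>k\<in>K. p k > 0) \<and> sum p K < 1
            then (\<Prod>k\<in>K. p k powr ((a k - c k) - 1)) * (1 - sum p K) powr ((a j - c j) - 1) else 0"
  have sp: "simplex_point I j p j = 1 - sum p K" "i \<in> K \<Longrightarrow> simplex_point I j p i = p i" for p i
    using K by (auto simp: simplex_point_def)
  have m: "(\<lambda>q. ennreal (\<Prod>i\<in>I. q i powr (- c i))) \<in> borel_measurable (\<Pi>\<^sub>M i\<in>I. borel)"
    using measurable_prod_powr[OF assms(1), of "\<lambda>i. - c i"] by simp
  have eq: "ennreal (dirichlet_density I a (simplex_point I j p)) * ennreal (\<Prod>i\<in>I. simplex_point I j p i powr (- c i))
     = ennreal ?C * ennreal (?G p)" for p
  proof (cases "(\<forall>k\<in>K. p k > 0) \<and> sum p K < 1")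
    case True
    then have pos: "\<forall>i\<in>I. simplex_point I j p i > 0" using K sp by auto
    have "dirichlet_density I a (simplex_point I j p) * (\<Prod>i\<in>I. simplex_point I j p i powr (- c i))
        = ?C * (\<Prod>i\<in>I. simplex_point I j p i powr (a i - c i - 1))"
      using pos unfolding dirichlet_density_def
      by (simp add: prod.distrib[symmetric] powr_add[symmetric] algebra_simps)
    also have "(\<Prod>i\<in>I. simplex_point I j p i powr (a i - c i - 1)) = ?G p"
      using True K sp by simp
    finally have e: "dirichlet_density I a (simplex_point I j p) * (\<Prod>i\<in>I. simplex_point I j p i powr (- c i)) = ?C * ?G p" .
    have nn1: "(\<Prod>i\<in>I. simplex_point I j p i powr (- c i)) \<ge> 0"
      by (intro prod_nonneg) simp
    have nn2: "?G p \<ge> 0"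
      by (auto intro!: prod_nonneg mult_nonneg_nonneg)
    show ?thesis
      unfolding ennreal_mult''[OF nn1, symmetric] ennreal_mult''[OF nn2, symmetric] e ..
  next
    case False
    then have "\<not> (\<forall>i\<in>I. simplex_point I j p i > 0)" using K sp by auto
    with False show ?thesis by (auto simp: dirichlet_density_def)
  qed
  have "(\<integral>\<^sup>+q. ennreal (\<Prod>i\<in>I. q i powr (- c i)) \<partial>dirichlet I j a) = (\<integral>\<^sup>+p. ennreal ?C * ennreal (?G p) \<partial>(\<Pi>\<^sub>M i\<in>K. lborel))"
    unfolding nn_integral_dirichlet[OF assms(1) m] eq K_def ..
  also have "\<dots> = ennreal ?C * (\<integral>\<^sup>+p. ennreal (?G p) \<partial>(\<Pi>\<^sub>M i\<in>K. lborel))"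
    using K by (intro nn_integral_cmult) measurable
  also have "(\<integral>\<^sup>+p. ennreal (?G p) \<partial>(\<Pi>\<^sub>M i\<in>K. lborel)) =
     ennreal ((\<Prod>k\<in>K. Gamma (a k - c k)) * Gamma (a j - c j) / Gamma ((\<Sum>k\<in>K. a k - c k) + (a j - c j)))"
    using assms K by (intro dirichlet_integral) auto
  finally show ?thesis using K by (simp add: ac_simps)
qed

lemma prob_space_dirichlet:
  assumes "finite I" "j \<in> I" "\<And>i. i \<in> I \<Longrightarrow> 0 < a i"
  shows "prob_space (dirichlet I j a)"
proof
  \<comment> \<open>The moment with exponent \<open>0\<close> is the total mass. Since \<open>0 powr 0 = 0\<close>, its integrand is \<open>1\<close> only where all
    coordinates are nonzero, but the density vanishes elsewhere.\<close>
  have total: "(\<integral>\<^sup>+q. ennreal (\<Prod>i\<in>I. q i powr (- 0)) \<partial>dirichlet I j a) = 1"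
  proof -
    have "sum a I > 0" using assms by (intro sum_pos) auto
    then have "Gamma (sum a I) > 0" "(\<Prod>i\<in>I. Gamma (a i)) > 0" using assms by (auto intro: Gamma_real_pos prod_Gamma_pos)
    then show ?thesis using dirichlet_moment[of I j "\<lambda>_. 0" a] assms
      by (simp add: ennreal_mult'[symmetric] del: prod_zero_iff)
  qed
  have m: "(\<lambda>q. ennreal (\<Prod>i\<in>I. q i powr (- 0))) \<in> borel_measurable (\<Pi>\<^sub>M i\<in>I. borel)"
    using measurable_prod_powr[OF assms(1), of "\<lambda>i. - 0"] by simp
  have "(\<integral>\<^sup>+q. ennreal (\<Prod>i\<in>I. q i powr (- 0)) \<partial>dirichlet I j a) = (\<integral>\<^sup>+q. 1 \<partial>dirichlet I j a)"
    using assms(1) unfolding nn_integral_dirichlet[OF assms(1) m] nn_integral_dirichlet[OF assms(1) borel_measurable_const]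
  proof (intro nn_integral_cong)
    fix p :: "'a \<Rightarrow> real"
    show "ennreal (dirichlet_density I a (simplex_point I j p)) * ennreal (\<Prod>i\<in>I. simplex_point I j p i powr (- 0))
      = ennreal (dirichlet_density I a (simplex_point I j p)) * 1"
    proof (cases "\<forall>i\<in>I. simplex_point I j p i > 0")
      case True
      then have "(\<Prod>i\<in>I. simplex_point I j p i powr (- 0)) = 1" by (intro prod.neutral) auto
      then show ?thesis by simp
    next
      case False
      then have "dirichlet_density I a (simplex_point I j p) = 0" by (auto simp: dirichlet_density_def)
      then show ?thesis by simp
    qed
  qed
  then show "emeasure (dirichlet I j a) (space (dirichlet I j a)) = 1"
    using total by simp
qed

lemma AE_dirichlet:
  assumes "finite I" "j \<in> I"
  shows "AE q in dirichlet I j a. (\<forall>i\<in>I. 0 < q i) \<and> sum q I = 1"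
proof -
  have cI: "countable I" using assms(1) by (rule countable_finite)
  have m [measurable]: "Measurable.pred (\<Pi>\<^sub>M i\<in>I. borel) (\<lambda>q. \<not> ((\<forall>i\<in>I. 0 < q i) \<and> sum q I = (1::real)))"
    using assms(1) cI by measurable
  let ?f = "\<lambda>q. indicator {q \<in> space (\<Pi>\<^sub>M i\<in>I. borel). \<not> ((\<forall>i\<in>I. 0 < q i) \<and> sum q I = (1::real))} q :: ennreal"
  have mf: "?f \<in> borel_measurable (\<Pi>\<^sub>M i\<in>I. borel)" by measurable
  have "(\<integral>\<^sup>+q. ?f q \<partial>dirichlet I j a) = (\<integral>\<^sup>+p. 0 \<partial>(\<Pi>\<^sub>M i\<in>I - {j}. (lborel :: real measure)))"
    unfolding nn_integral_dirichlet[OF assms(1) mf]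
  proof (intro nn_integral_cong)
    fix p :: "'a \<Rightarrow> real"
    have "sum (simplex_point I j p) I = 1"
      using assms by (subst sum.remove[of I j]) (auto simp: simplex_point_def)
    then show "ennreal (dirichlet_density I a (simplex_point I j p)) * ?f (simplex_point I j p) = 0"
      by (auto simp: dirichlet_density_def indicator_def)
  qed
  then have "AE q in dirichlet I j a. ?f q = 0"
    using mf by (intro iffD1[OF nn_integral_0_iff_AE]) simp_all
  moreover have "AE q in dirichlet I j a. q \<in> space (\<Pi>\<^sub>M i\<in>I. borel)"
    using AE_space[of "dirichlet I j a"] by (simp add: space_dirichlet)
  ultimately show ?thesis by eventually_elim (auto simp: indicator_def split: if_splits)
qed

text \<open>
  On the interval from \<open>r * v\<close> to \<open>v\<close>, a power function of either sign of exponent is comparable to its value at \<open>v\<close>.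
\<close>

lemma powr_lower_bound:
  fixes r u v e :: real
  assumes "0 < r" "r \<le> 1" "0 < v" "r * v \<le> u" "u \<le> v"
  shows "min 1 (r powr e) * v powr e \<le> u powr e"
proof -
  have u: "0 < u" using assms by (metis less_le_trans mult_pos_pos)
  have q: "u = (u / v) * v" "r \<le> u / v" "u / v \<le> 1" "0 < u / v"
    using assms u by (auto simp: field_simps)
  have "min 1 (r powr e) \<le> (u / v) powr e"
  proof (cases "e \<ge> 0")
    case True
    then have "r powr e \<le> (u / v) powr e" using q assms by (intro powr_mono2) auto
    then show ?thesis by simp
  next
    case False
    then have "1 powr e \<le> (u / v) powr e" using q by (intro powr_mono2') auto
    then show ?thesis by simp
  qed
  then have "min 1 (r powr e) * v powr e \<le> (u / v) powr e * v powr e"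
    by (intro mult_right_mono) auto
  also have "\<dots> = u powr e" using assms u q by (subst powr_mult[symmetric]) auto
  finally show ?thesis .
qed

text \<open>
  The probability that the coordinates outside \<open>J\<close> are small while those in \<open>J\<close> are not. Each small coordinate
  contributes a factor \<open>t powr a i\<close>, because its density behaves like \<open>q powr (a i - 1)\<close> near \<open>0\<close>. A coordinate in \<open>J\<close> serves as
  pivot: it takes up the remaining mass and stays at least \<open>2 * c\<close> when all others are at most \<open>2 * c\<close>.
\<close>

lemma dirichlet_box:
  fixes I J :: "'i set" and a :: "'i \<Rightarrow> real"
  assumes I: "finite I" "j \<in> I" and a: "\<And>i. i \<in> I \<Longrightarrow> 0 < a i"
    and J: "J \<subseteq> I" "J \<noteq> {}"
  defines "c \<equiv> 1 / (2 * real (card I))"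
  shows "\<exists>\<delta>>0. \<forall>t. 0 < t \<and> t \<le> 2 * c \<longrightarrow>
     ennreal (\<delta> * t powr sum a (I - J)) \<le> emeasure (dirichlet I j a)
       {q \<in> space (\<Pi>\<^sub>M i\<in>I. borel). (\<forall>i\<in>J. c \<le> q i) \<and> (\<forall>i\<in>I - J. q i \<le> t)}"
proof -
  interpret product_sigma_finite "\<lambda>_::'i. lborel :: real measure"
    by standard
  obtain k where k: "k \<in> J" "k \<in> I" using J by auto
  define K where "K = I - {k}"
  have K: "finite K" "k \<notin> K" and IK: "I = insert k K" using I(1) k by (auto simp: K_def)
  have cardI: "card I = Suc (card K)" unfolding IK using K by simp
  have c: "0 < c" "c \<le> 1" "2 * c * real (card K) = 1 - 2 * c"
    by (auto simp: c_def cardI field_simps)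
  define C where "C = Gamma (sum a I) / (\<Prod>i\<in>I. Gamma (a i))"
  have "sum a I > 0" using I a by (intro sum_pos) auto
  then have C: "C > 0" unfolding C_def using a by (intro divide_pos_pos Gamma_real_pos prod_Gamma_pos) auto
  \<comment> \<open>The box \<open>B\<close> below has sides from \<open>t / 2\<close> to \<open>t\<close> outside \<open>J\<close> and from \<open>c\<close> to \<open>2 * c\<close> in \<open>J\<close>. With the scale \<open>v i\<close> (\<open>t\<close> or \<open>1\<close>),
    each side has length \<open>r i * v i\<close> and lies between \<open>r i * v i\<close> and \<open>v i\<close>, so both kinds can be treated alike.\<close>
  define r where "r i = (if i \<in> J then c else 1 / 2)" for i
  define m where "m i = min 1 (r i powr (a i - 1))" for i
  have r: "0 < r i" "r i \<le> 1" for i using c by (auto simp: r_def)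
  have m: "0 < m i" for i using r[of i] by (auto simp: m_def)
  define \<delta> where "\<delta> = C * prod m I * prod r K"
  have \<delta>: "\<delta> > 0" unfolding \<delta>_def using C m r by (intro mult_pos_pos prod_pos) auto
  have "ennreal (\<delta> * t powr sum a (I - J)) \<le> emeasure (dirichlet I j a)
       {q \<in> space (\<Pi>\<^sub>M i\<in>I. borel). (\<forall>i\<in>J. c \<le> q i) \<and> (\<forall>i\<in>I - J. q i \<le> t)}" (is "_ \<le> emeasure _ ?A")
    if t: "0 < t" "t \<le> 2 * c" for t
  proof -
    define v where "v i = (if i \<in> J then 1 else t)" for i
    have v: "0 < v i" for i using t by (auto simp: v_def)
    define B where "B i = (if i \<in> J then {c..2 * c} else {t / 2..t})" for i
    have A: "?A \<in> sets (\<Pi>\<^sub>M i\<in>I. borel)"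
    proof -
      have "countable I" "finite J" "finite (I - J)" using I J by (auto intro: countable_finite finite_subset)
      moreover have "(\<lambda>q. q i) \<in> borel_measurable (\<Pi>\<^sub>M i\<in>I. borel)" if "i \<in> I" for i
        using that by measurable
      ultimately show ?thesis using J
        by (intro sets.sets_Collect_conj sets.sets_Collect_finite_All borel_measurable_le) auto
    qed
    define D where "D = C * (\<Prod>i\<in>I. m i * v i powr (a i - 1))"
    have main: "ennreal D * indicator (PiE K B) p
       \<le> ennreal (dirichlet_density I a (simplex_point I k p)) * indicator ?A (simplex_point I k p)" for p
    proof (cases "p \<in> PiE K B")
      case True
      let ?q = "simplex_point I k p"
      have sp: "?q k = 1 - sum p K" "i \<in> K \<Longrightarrow> ?q i = p i" for i
        using k by (auto simp: simplex_point_def K_def)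
      have pB: "p i \<in> B i" if "i \<in> K" for i using True that by auto
      have p2: "0 \<le> p i" "p i \<le> 2 * c" if "i \<in> K" for i
        using pB[OF that] t c by (auto simp: B_def split: if_splits)
      have "sum p K \<le> real (card K) * (2 * c)" using p2 by (intro sum_bounded_above) auto
      then have "c \<le> ?q k" using c sp by (simp add: algebra_simps)
      moreover have "?q k \<le> 1" using sp p2 by (simp add: sum_nonneg)
      moreover have "p i \<le> 1" if "i \<in> K" for i
      proof -
        have "2 * c \<le> 2 * c * real (card K)" using K that c
          by (metis One_nat_def Suc_leI card_gt_0_iff emptyE mult.right_neutral mult_left_mono of_nat_1 of_nat_mono zero_le_mult_iff less_imp_le zero_le_numeral)
        then show ?thesis using p2[OF that] c by linarith
      qed
      ultimately have q: "r i * v i \<le> ?q i" "?q i \<le> v i" if "i \<in> I" for i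
        using that pB[of i] k sp c unfolding r_def v_def B_def IK by (auto split: if_splits)
      have qpos: "0 < ?q i" if "i \<in> I" for i
        using q(1)[OF that] mult_pos_pos[OF r(1)[of i] v[of i]] by linarith
      have "D \<le> C * (\<Prod>i\<in>I. ?q i powr (a i - 1))"
        unfolding D_def
      proof (intro mult_left_mono prod_mono conjI)
        fix i assume i: "i \<in> I"
        show "0 \<le> m i * v i powr (a i - 1)" using m[of i] by simp
        show "m i * v i powr (a i - 1) \<le> ?q i powr (a i - 1)"
          unfolding m_def using r v q[OF i] by (intro powr_lower_bound) auto
      qed (use C in auto)
      then have "D \<le> dirichlet_density I a ?q" using qpos by (simp add: dirichlet_density_def C_def)
      moreover have "?q \<in> ?A"
      proof -
        have "?q \<in> space (\<Pi>\<^sub>M i\<in>I. borel)" by (auto simp: simplex_point_def space_PiM)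
        moreover have "c \<le> ?q i" if "i \<in> J" for i using q(1)[of i] that J by (auto simp: r_def v_def)
        moreover have "?q i \<le> t" if "i \<in> I - J" for i using q(2)[of i] that by (auto simp: v_def)
        ultimately show ?thesis by auto
      qed
      ultimately show ?thesis using True by (simp add: ennreal_leI)
    qed simp
    have "ennreal (\<delta> * t powr sum a (I - J)) = ennreal D * emeasure (\<Pi>\<^sub>M i\<in>K. lborel) (PiE K B)"
    proof -
      have "emeasure (\<Pi>\<^sub>M i\<in>K. lborel) (PiE K B) = (\<Prod>i\<in>K. emeasure lborel (B i))"
        using K by (intro emeasure_PiM) (auto simp: B_def)
      also have "\<dots> = (\<Prod>i\<in>K. ennreal (r i * v i))"
        using t c by (intro prod.cong) (auto simp: B_def r_def v_def)
      also have "\<dots> = ennreal (\<Prod>i\<in>K. r i * v i)"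
        using r v by (intro prod_ennreal) (auto intro: mult_nonneg_nonneg less_imp_le)
      finally have e: "emeasure (\<Pi>\<^sub>M i\<in>K. lborel) (PiE K B) = ennreal (\<Prod>i\<in>K. r i * v i)" .
      have "(\<Prod>i\<in>I. v i powr (a i - 1)) * prod v K = (\<Prod>i\<in>I. v i powr a i)"
      proof -
        have "prod v K = prod v I" unfolding IK using K k by (simp add: v_def)
        moreover have "v i powr (a i - 1) * v i = v i powr a i" for i
          using v[of i] by (simp add: powr_diff)
        ultimately show ?thesis by (simp add: prod.distrib[symmetric])
      qed
      also have "\<dots> = (\<Prod>i\<in>I - J. v i powr a i)"
        using I by (intro prod.mono_neutral_right) (auto simp: v_def)
      also have "\<dots> = (\<Prod>i\<in>I - J. t powr a i)"
        by (intro prod.cong) (auto simp: v_def)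
      also have "\<dots> = t powr sum a (I - J)"
        using t I by (simp add: powr_sum)
      finally have "t powr sum a (I - J) = (\<Prod>i\<in>I. v i powr (a i - 1)) * prod v K" ..
      then have "\<delta> * t powr sum a (I - J) = D * (\<Prod>i\<in>K. r i * v i)"
        by (simp add: \<delta>_def D_def prod.distrib)
      moreover have "0 \<le> (\<Prod>i\<in>K. r i * v i)" using r v by (intro prod_nonneg) (auto intro: mult_nonneg_nonneg less_imp_le)
      ultimately show ?thesis unfolding e by (metis ennreal_mult'')
    qed
    also have "\<dots> = (\<integral>\<^sup>+p. ennreal D * indicator (PiE K B) p \<partial>(\<Pi>\<^sub>M i\<in>K. lborel))"
      using K by (intro nn_integral_cmult_indicator[symmetric] sets_PiM_I_finite) (auto simp: B_def)
    also have "\<dots> \<le> (\<integral>\<^sup>+p. ennreal (dirichlet_density I a (simplex_point I k p)) * indicator ?A (simplex_point I k p) \<partial>(\<Pi>\<^sub>M i\<in>K. lborel))"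
      by (intro nn_integral_mono main)
    also have "\<dots> = (\<integral>\<^sup>+q. indicator ?A q \<partial>dirichlet I k a)"
      unfolding K_def by (intro nn_integral_dirichlet[symmetric] I borel_measurable_indicator A)
    also have "\<dots> = emeasure (dirichlet I k a) ?A"
      using A by (intro nn_integral_indicator) simp
    also have "dirichlet I k a = dirichlet I j a"
      using I k by (intro dirichlet_change_pivot)
    finally show ?thesis .
  qed
  then show ?thesis using \<delta> by blast
qed


section \<open>Strongly connected sets and exit weights\<close>

lemma steps_finite [simp]: "finite (steps L R \<alpha>)"
  unfolding steps_def by (rule finite_subset[of _ "{-L..R}"]) auto

lemma exit_weight_eq:
  assumes "finite S"
  shows "exit_weight L R \<alpha> S = (\<Sum>x\<in>S. \<Sum>i | i \<in> steps L R \<alpha> \<and> x + i \<notin> S. \<alpha> i)"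
proof -
  have "(\<Sum>x\<in>S. \<Sum>i | i \<in> steps L R \<alpha> \<and> x + i \<notin> S. \<alpha> i)
      = (\<Sum>(x, i)\<in>(SIGMA x:S. {i \<in> steps L R \<alpha>. x + i \<notin> S}). \<alpha> i)"
    using assms by (intro sum.Sigma) auto
  also have "\<dots> = exit_weight L R \<alpha> S"
    unfolding exit_weight_def edges_def
    by (intro sum.reindex_bij_witness[of _ "\<lambda>(x, y). (x, y - x)" "\<lambda>(x, i). (x, x + i)"]) auto
  finally show ?thesis ..
qed

text \<open>
  A finite set in which each vertex keeps a successor contains a sink class of the induced subgraph: the set
  of vertices reachable from \<open>x\<close>, for an \<open>x\<close> that minimises its cardinality, is closed under successors in \<open>B\<close>, and
  by minimality each of its vertices reaches all of it.
\<close>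

lemma strongly_conn_sink:
  assumes "finite B" "B \<noteq> {}" "\<And>x. x \<in> B \<Longrightarrow> \<exists>y\<in>B. (x, y) \<in> E"
  shows "\<exists>C\<subseteq>B. strongly_conn E C \<and> (\<forall>x\<in>C. \<forall>y\<in>B. (x, y) \<in> E \<longrightarrow> y \<in> C)"
proof -
  define F where "F = E \<inter> B \<times> B"
  define reach where "reach x = {y. (x, y) \<in> F\<^sup>+}" for x
  have sub: "reach x \<subseteq> B" for x
    using trancl_subset_Sigma[of F B] by (auto simp: reach_def F_def)
  have fin: "finite (reach x)" for x using sub assms(1) by (rule finite_subset)
  obtain x where x: "x \<in> B" "\<And>y. y \<in> B \<Longrightarrow> card (reach x) \<le> card (reach y)"
    using ex_has_least_nat[of "\<lambda>x. x \<in> B" _ "\<lambda>x. card (reach x)"] assms(2) by blast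
  define C where "C = reach x"
  have nonempty: "C \<noteq> {}"
  proof -
    obtain y where "y \<in> B" "(x, y) \<in> E" using assms(3) x(1) by blast
    then have "y \<in> C" using x(1) by (auto simp: C_def reach_def F_def)
    then show ?thesis by blast
  qed
  have closed: "z \<in> C" if "y \<in> C" "(y, z) \<in> F" for y z
    using that by (auto simp: C_def reach_def)
  have same: "reach y = C" if "y \<in> C" for y
  proof -
    have "reach y \<subseteq> C" using that by (auto simp: C_def reach_def)
    moreover have "card C \<le> card (reach y)" using x(2)[of y] that sub C_def by blast
    ultimately show ?thesis using card_seteq[of C "reach y"] fin C_def by blast
  qed
  have stay: "(y, z) \<in> (E \<inter> C \<times> C)\<^sup>+" if "(y, z) \<in> F\<^sup>+" "y \<in> C" for y z
    using that
  proof (induction rule: trancl_induct)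
    case (base z)
    then show ?case using closed by (auto simp: F_def)
  next
    case (step z w)
    then have z: "(y, z) \<in> (E \<inter> C \<times> C)\<^sup>+" by simp
    then have "z \<in> C" by (metis IntE mem_Sigma_iff tranclE)
    then have "(z, w) \<in> E \<inter> C \<times> C" using step.hyps(2) closed by (auto simp: F_def)
    with z show ?case by (rule trancl_into_trancl)
  qed
  have "strongly_conn E C"
    unfolding strongly_conn_def using nonempty stay same by (auto simp: reach_def)
  moreover have "\<forall>x\<in>C. \<forall>y\<in>B. (x, y) \<in> E \<longrightarrow> y \<in> C"
    using closed sub by (auto simp: F_def C_def)
  ultimately show ?thesis using sub C_def by blast
qed

text \<open>
  A bound on the exit weights of strongly connected sets extends to sets that are not strongly connected but have
  no dead ends: all edges that leave the sink class of \<open>B\<close> leave \<open>B\<close> as well.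
\<close>

lemma exit_weight_lower_bound:
  assumes \<kappa>: "\<And>C. finite C \<Longrightarrow> strongly_conn (edges L R \<alpha>) C \<Longrightarrow> \<kappa> \<le> exit_weight L R \<alpha> C"
    and B: "finite B" "B \<noteq> {}" "\<And>x. x \<in> B \<Longrightarrow> \<exists>i\<in>steps L R \<alpha>. x + i \<in> B"
  shows "\<kappa> \<le> exit_weight L R \<alpha> B"
proof -
  have "\<exists>y\<in>B. (x, y) \<in> edges L R \<alpha>" if "x \<in> B" for x
  proof -
    obtain i where "i \<in> steps L R \<alpha>" "x + i \<in> B" using B(3)[OF \<open>x \<in> B\<close>] by blast
    then show ?thesis by (intro bexI[of _ "x + i"]) (auto simp: edges_def)
  qed
  then obtain C where C: "C \<subseteq> B" "strongly_conn (edges L R \<alpha>) C"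
      "\<forall>x\<in>C. \<forall>y\<in>B. (x, y) \<in> edges L R \<alpha> \<longrightarrow> y \<in> C"
    using strongly_conn_sink[OF B(1,2), of "edges L R \<alpha>"] by blast
  have pos: "i \<in> steps L R \<alpha> \<Longrightarrow> \<alpha> i \<ge> 0" for i by (auto simp: steps_def)
  have "\<kappa> \<le> exit_weight L R \<alpha> C" using \<kappa> C B(1) finite_subset by blast
  also have "\<dots> = (\<Sum>x\<in>C. \<Sum>i | i \<in> steps L R \<alpha> \<and> x + i \<notin> C. \<alpha> i)"
    using C B(1) finite_subset by (intro exit_weight_eq) blast
  also have "\<dots> = (\<Sum>x\<in>C. \<Sum>i | i \<in> steps L R \<alpha> \<and> x + i \<notin> B. \<alpha> i)"
    using C by (intro sum.cong) (auto simp: edges_def)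
  also have "\<dots> \<le> (\<Sum>x\<in>B. \<Sum>i | i \<in> steps L R \<alpha> \<and> x + i \<notin> B. \<alpha> i)"
    using B C pos by (intro sum_mono2 sum_nonneg) auto
  also have "\<dots> = exit_weight L R \<alpha> B" using exit_weight_eq[OF B(1)] ..
  finally show ?thesis .
qed

text \<open>
  The infimum cannot be approached strictly from above: an exit weight is a combination of the finitely many
  positive \<open>\<alpha> i\<close> with natural coefficients (the numbers of exits along the step \<open>i\<close>), and a bound on the sum bounds the
  coefficients. So the exit weights below \<open>s + 1\<close> form a finite set.
\<close>

lemma kappa0_attained:
  assumes "kappa0 L R \<alpha> \<le> ereal s"
  obtains S where "finite S" "strongly_conn (edges L R \<alpha>) S" "exit_weight L R \<alpha> S \<le> s"
proof -
  let ?I = "steps L R \<alpha>"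
  let ?SC = "{S. finite S \<and> strongly_conn (edges L R \<alpha>) S}"
  let ?W = "{exit_weight L R \<alpha> S | S. S \<in> ?SC \<and> exit_weight L R \<alpha> S \<le> s + 1}"
  have pos: "i \<in> ?I \<Longrightarrow> \<alpha> i > 0" for i by (auto simp: steps_def)
  obtain m :: nat where m: "\<And>i. i \<in> ?I \<Longrightarrow> (s + 1) / \<alpha> i < real m"
  proof -
    obtain m :: nat where "Max ((\<lambda>i. (s + 1) / \<alpha> i) ` insert 0 ?I) < real m"
      using reals_Archimedean2 by blast
    moreover have "(s + 1) / \<alpha> i \<le> Max ((\<lambda>i. (s + 1) / \<alpha> i) ` insert 0 ?I)" if "i \<in> ?I" for i
      using that by (intro Max_ge) auto
    ultimately show ?thesis using that le_less_trans by blast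
  qed
  have "?W \<subseteq> (\<lambda>k. \<Sum>i\<in>?I. real (k i) * \<alpha> i) ` (PiE ?I (\<lambda>_. {..m}))"
  proof
    fix w assume "w \<in> ?W"
    then obtain S where S: "finite S" "w = exit_weight L R \<alpha> S" "w \<le> s + 1" by blast
    define k where "k i = card {x \<in> S. x + i \<notin> S}" for i
    have w: "w = (\<Sum>i\<in>?I. real (k i) * \<alpha> i)"
    proof -
      have "w = (\<Sum>x\<in>S. \<Sum>i\<in>?I. if x + i \<notin> S then \<alpha> i else 0)"
        unfolding S(2) exit_weight_eq[OF S(1)] by (intro sum.cong refl sum.inter_filter) simp
      also have "\<dots> = (\<Sum>i\<in>?I. \<Sum>x\<in>S. if x + i \<notin> S then \<alpha> i else 0)"
        by (rule sum.swap)
      also have "\<dots> = (\<Sum>i\<in>?I. real (k i) * \<alpha> i)"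
        using S(1) by (intro sum.cong refl) (simp add: k_def sum.inter_filter[symmetric])
      finally show ?thesis .
    qed
    have "k i \<le> m" if i: "i \<in> ?I" for i
    proof -
      have "real (k i) * \<alpha> i \<le> (\<Sum>i\<in>?I. real (k i) * \<alpha> i)"
        using i pos by (intro member_le_sum) (auto simp: less_imp_le)
      then have "real (k i) \<le> (s + 1) / \<alpha> i" using w S(3) pos[OF i] by (simp add: field_simps)
      then show ?thesis using m[OF i] by linarith
    qed
    then have "restrict k ?I \<in> PiE ?I (\<lambda>_. {..m})" by auto
    moreover have "w = (\<Sum>i\<in>?I. real (restrict k ?I i) * \<alpha> i)" unfolding w by simp
    ultimately show "w \<in> (\<lambda>k. \<Sum>i\<in>?I. real (k i) * \<alpha> i) ` (PiE ?I (\<lambda>_. {..m}))" by blast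
  qed
  then have fin: "finite ?W" by (rule finite_subset) (auto intro!: finite_PiE)
  have "\<exists>S\<in>?SC. exit_weight L R \<alpha> S \<le> s"
  proof (rule ccontr)
    assume "\<not> (\<exists>S\<in>?SC. exit_weight L R \<alpha> S \<le> s)"
    then have gt: "s < exit_weight L R \<alpha> S" if "S \<in> ?SC" for S using that by force
    define w where "w = Min (insert (s + 1) ?W)"
    have sw: "s < w" unfolding w_def using fin gt by (subst Min_gr_iff) auto
    have "w \<le> exit_weight L R \<alpha> S" if "S \<in> ?SC" for S
    proof (cases "exit_weight L R \<alpha> S \<le> s + 1")
      case True
      then show ?thesis unfolding w_def using fin that by (intro Min_le) auto
    next
      case False
      moreover have "w \<le> s + 1" unfolding w_def using fin by (intro Min_le) auto
      ultimately show ?thesis by simp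
    qed
    then have "ereal w \<le> kappa0 L R \<alpha>" unfolding kappa0_def by (intro INF_greatest) auto
    then have "ereal w \<le> ereal s" using assms by (rule order_trans)
    then show False using sw by simp
  qed
  then show ?thesis using that by blast
qed

lemma strongly_conn_translate:
  fixes S :: "int set"
  assumes "strongly_conn (edges L R \<alpha>) S"
  shows "strongly_conn (edges L R \<alpha>) ((\<lambda>x. x + c) ` S)"
proof -
  let ?f = "\<lambda>x. x + c"
  have "(?f x, ?f y) \<in> (edges L R \<alpha> \<inter> ?f ` S \<times> ?f ` S)\<^sup>+" if "(x, y) \<in> (edges L R \<alpha> \<inter> S \<times> S)\<^sup>+" for x y
    using that
  proof (induction rule: trancl_induct)
    case (base y)
    then show ?case by (intro r_into_trancl) (auto simp: edges_def)
  next
    case (step y z)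
    then have "(?f y, ?f z) \<in> edges L R \<alpha> \<inter> ?f ` S \<times> ?f ` S" by (auto simp: edges_def)
    with step.IH show ?case by (rule trancl_into_trancl)
  qed
  with assms show ?thesis by (auto simp: strongly_conn_def)
qed

lemma exit_weight_translate:
  assumes "finite S"
  shows "exit_weight L R \<alpha> ((\<lambda>x. x + c) ` S) = exit_weight L R \<alpha> S"
proof -
  have e: "x + c + i \<in> (\<lambda>x. x + c) ` S \<longleftrightarrow> x + i \<in> S" for x i
    by (auto simp: image_iff)
  show ?thesis using assms
    by (simp add: exit_weight_eq sum.reindex inj_on_def e)
qed


section \<open>The Green function of the killed walk\<close>

text \<open>
  The probability that the walk from \<open>z\<close> is at \<open>x\<close> at time \<open>n\<close>, having stayed in \<open>S\<close> at all earlier times.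
  The position \<open>x\<close> itself may lie outside \<open>S\<close>, which then records an exit from \<open>S\<close> at time \<open>n\<close> through \<open>x\<close>.
\<close>

primrec killed_prob :: "('a \<Rightarrow> 'a \<Rightarrow> real) \<Rightarrow> 'a set \<Rightarrow> 'a \<Rightarrow> nat \<Rightarrow> 'a \<Rightarrow> real" where
  "killed_prob \<omega> S z 0 x = (if x = z then 1 else 0)"
| "killed_prob \<omega> S z (Suc n) x = (\<Sum>y\<in>S. killed_prob \<omega> S z n y * \<omega> y x)"

lemma space_chain_law [simp]: "space (chain_law K z) = UNIV"
  using sets_eq_imp_space_eq[OF sets_chain_law[of K z]] by (simp add: space_PiM)

lemma sets_chain_law_coord: "{X. P (X n)} \<in> sets (chain_law K z)"
proof -
  have "(\<lambda>X. X n) \<in> measurable (\<Pi>\<^sub>M n\<in>(UNIV::nat set). count_space UNIV) (count_space UNIV)"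
    by (rule measurable_component_singleton) simp
  then have "(\<lambda>X. X n) -` {x. P x} \<inter> space (\<Pi>\<^sub>M n\<in>(UNIV::nat set). count_space UNIV) \<in> sets (\<Pi>\<^sub>M n\<in>(UNIV::nat set). count_space UNIV)"
    by (rule measurable_sets) simp
  then show ?thesis by (simp add: sets_chain_law space_PiM vimage_def)
qed

lemma sets_chain_law_All: "{X. \<forall>k\<le>n. P k (X k)} \<in> sets (chain_law K z)"
proof -
  have "{X. \<forall>k\<le>n. P k (X k)} = (\<Inter>k\<in>{..n}. {X. P k (X k)})" by auto
  also have "\<dots> \<in> sets (chain_law K z)"
    by (intro sets.finite_INT) (auto intro: sets_chain_law_coord)
  finally show ?thesis .
qed

lemma sets_chain_law_visit: "{X. X n = x \<and> (\<forall>k\<le>n. X k \<in> S)} \<in> sets (chain_law K z)"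
proof -
  have "{X. X n = x \<and> (\<forall>k\<le>n. X k \<in> S)} = {X. X n = x} \<inter> {X. \<forall>k\<le>n. X k \<in> S}" by auto
  also have "\<dots> \<in> sets (chain_law K z)"
    by (intro sets.Int sets_chain_law_coord[of "\<lambda>y. y = x"] sets_chain_law_All[of n "\<lambda>_ y. y \<in> S"])
  finally show ?thesis .
qed

text \<open>
  The event is a finite disjoint union of cylinders, one for each path in \<open>S\<close> that ends in \<open>x\<close>; splitting off the last
  step of the path gives the recursion that defines \<open>killed_prob\<close>.
\<close>

lemma emeasure_chain_law_killed:
  assumes S: "finite S" "x \<in> S"
  shows "emeasure (chain_law K z) {X. X n = x \<and> (\<forall>k\<le>n. X k \<in> S)} = ennreal (killed_prob (\<lambda>y. pmf (K y)) S z n x)"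
proof -
  define A where "A n = PiE {..n} (\<lambda>_. S)" for n :: nat
  define W where "W n a = (if a 0 = z then \<Prod>i<n. pmf (K (a i)) (a (Suc i)) else 0)" for n and a :: "nat \<Rightarrow> 'a"
  define cyl where "cyl n a = {X :: nat \<Rightarrow> 'a. \<forall>i\<le>n. X i = a i}" for n and a
  have finA: "finite (A n)" for n unfolding A_def using S by (intro finite_PiE) auto
  have W0: "W n a \<ge> 0" for n a by (auto simp: W_def intro!: prod_nonneg)
  have sum_W: "(\<Sum>a\<in>{a \<in> A n. a n = x}. W n a) = killed_prob (\<lambda>y. pmf (K y)) S z n x" if "x \<in> S" for n x
    using that
  proof (induction n arbitrary: x)
    case 0
    have "{a \<in> A 0. a 0 = x} = {restrict (\<lambda>_. x) {..0}}"
      using 0 by (auto simp: A_def fun_eq_iff PiE_def extensional_def)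
    then show ?case by (simp add: W_def)
  next
    case (Suc n)
    have "(\<Sum>b\<in>{b \<in> A (Suc n). b (Suc n) = x}. W (Suc n) b) = (\<Sum>a\<in>A n. W n a * pmf (K (a n)) x)"
    proof (rule sum.reindex_bij_witness[of _ "\<lambda>a. a(Suc n := x)" "\<lambda>b. restrict b {..n}"])
      fix b assume b: "b \<in> {b \<in> A (Suc n). b (Suc n) = x}"
      show "(restrict b {..n})(Suc n := x) = b"
        using b by (auto simp: A_def fun_eq_iff PiE_def extensional_def)
      show "restrict b {..n} \<in> A n" using b by (auto simp: A_def)
      show "W n (restrict b {..n}) * pmf (K (restrict b {..n} n)) x = W (Suc n) b"
        using b by (auto simp: W_def intro!: arg_cong2[where f = "(*)"] prod.cong)
    next
      fix a assume a: "a \<in> A n"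
      show "restrict (a(Suc n := x)) {..n} = a"
        using a by (auto simp: A_def fun_eq_iff PiE_def extensional_def)
      show "a(Suc n := x) \<in> {b \<in> A (Suc n). b (Suc n) = x}"
        using a Suc.prems by (auto simp: A_def PiE_def extensional_def Pi_iff)
    qed
    also have "\<dots> = (\<Sum>y\<in>S. \<Sum>a\<in>{a \<in> A n. a n = y}. W n a * pmf (K (a n)) x)"
      using S(1) finA by (intro sum.group[symmetric]) (auto simp: A_def)
    also have "\<dots> = (\<Sum>y\<in>S. (\<Sum>a\<in>{a \<in> A n. a n = y}. W n a) * pmf (K y) x)"
      unfolding sum_distrib_right by (intro sum.cong) auto
    also have "\<dots> = killed_prob (\<lambda>y. pmf (K y)) S z (Suc n) x"
      using Suc.IH by simp
    finally show ?case .
  qed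
  have "{X. X n = x \<and> (\<forall>k\<le>n. X k \<in> S)} = (\<Union>a\<in>{a \<in> A n. a n = x}. cyl n a)"
  proof (intro set_eqI iffI)
    fix X assume X: "X \<in> {X. X n = x \<and> (\<forall>k\<le>n. X k \<in> S)}"
    then show "X \<in> (\<Union>a\<in>{a \<in> A n. a n = x}. cyl n a)"
      by (intro UN_I[of "restrict X {..n}"]) (auto simp: A_def cyl_def)
  qed (auto simp: A_def cyl_def PiE_def Pi_iff)
  also have "emeasure (chain_law K z) \<dots> = (\<Sum>a\<in>{a \<in> A n. a n = x}. emeasure (chain_law K z) (cyl n a))"
  proof (rule sum_emeasure[symmetric])
    show "cyl n ` {a \<in> A n. a n = x} \<subseteq> sets (chain_law K z)"
      unfolding cyl_def by (intro image_subsetI sets_chain_law_All)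
    show "disjoint_family_on (cyl n) {a \<in> A n. a n = x}"
      unfolding disjoint_family_on_def
    proof (intro ballI impI)
      fix a b assume ab: "a \<in> {a \<in> A n. a n = x}" "b \<in> {a \<in> A n. a n = x}" "a \<noteq> b"
      have "a = b" if "X \<in> cyl n a" "X \<in> cyl n b" for X
        using that ab(1,2) unfolding cyl_def A_def
        by (intro PiE_ext[of a "{..n}" "\<lambda>_. S" b]) auto
      then show "cyl n a \<inter> cyl n b = {}" using ab(3) by blast
    qed
  qed (use finA in simp)
  also have "\<dots> = (\<Sum>a\<in>{a \<in> A n. a n = x}. ennreal (W n a))"
    unfolding cyl_def chain_law_cylinder W_def ..
  also have "\<dots> = ennreal (\<Sum>a\<in>{a \<in> A n. a n = x}. W n a)"
    using W0 by (intro sum_ennreal) auto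
  also have "\<dots> = ennreal (killed_prob (\<lambda>y. pmf (K y)) S z n x)"
    using sum_W[OF S(2)] by simp
  finally show ?thesis .
qed

lemma expected_visits_chain_law:
  assumes "finite S" "x \<in> S"
  shows "(\<integral>\<^sup>+X. visits S x X \<partial>chain_law K z) = (\<Sum>n. ennreal (killed_prob (\<lambda>y. pmf (K y)) S z n x))"
proof -
  let ?E = "\<lambda>n. {X. X n = x \<and> (\<forall>k\<le>n. X k \<in> S)}"
  have "visits S x X = (\<Sum>n. indicator (?E n) X)" for X
  proof -
    have "visits S x X = (\<integral>\<^sup>+n. indicator {n. X n = x \<and> (\<forall>k\<le>n. X k \<in> S)} n \<partial>count_space UNIV)"
      unfolding visits_def by simp
    also have "\<dots> = (\<Sum>n. indicator {n. X n = x \<and> (\<forall>k\<le>n. X k \<in> S)} n)"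
      by (rule nn_integral_count_space_nat)
    also have "\<dots> = (\<Sum>n. indicator (?E n) X)" by (simp add: indicator_def)
    finally show ?thesis .
  qed
  then have "(\<integral>\<^sup>+X. visits S x X \<partial>chain_law K z) = (\<integral>\<^sup>+X. (\<Sum>n. indicator (?E n) X) \<partial>chain_law K z)" by simp
  also have "\<dots> = (\<Sum>n. \<integral>\<^sup>+X. indicator (?E n) X \<partial>chain_law K z)"
    by (intro nn_integral_suminf borel_measurable_indicator sets_chain_law_visit)
  also have "\<dots> = (\<Sum>n. ennreal (killed_prob (\<lambda>y. pmf (K y)) S z n x))"
    using assms by (simp add: nn_integral_indicator[OF sets_chain_law_visit] emeasure_chain_law_killed)
  finally show ?thesis .
qed

text \<open>
  Almost every Dirichlet environment has this property, and on such arrays the conversion of rows to probability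
  mass functions loses nothing.
\<close>

definition positive_env :: "int set \<Rightarrow> (int \<Rightarrow> int \<Rightarrow> real) \<Rightarrow> bool" where
  "positive_env I \<omega> \<longleftrightarrow> (\<forall>x. (\<forall>i\<in>I. 0 < \<omega> x (x + i)) \<and> (\<Sum>i\<in>I. \<omega> x (x + i)) = 1 \<and> (\<forall>y. y - x \<notin> I \<longrightarrow> \<omega> x y = 0))"

lemma positive_env_nonneg: "positive_env I \<omega> \<Longrightarrow> 0 \<le> \<omega> x y"
proof -
  assume p: "positive_env I \<omega>"
  show ?thesis
  proof (cases "y - x \<in> I")
    case True
    then have "0 < \<omega> x (x + (y - x))" using p unfolding positive_env_def by blast
    then show ?thesis by simp
  qed (use p in \<open>auto simp: positive_env_def\<close>)
qed

lemma pmf_embed_positive_env: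
  assumes "finite I" "positive_env I \<omega>"
  shows "pmf (embed_pmf (\<omega> x)) y = \<omega> x y"
proof (rule pmf_embed_pmf)
  show "0 \<le> \<omega> x y" for y by (rule positive_env_nonneg[OF assms(2)])
  have "(\<integral>\<^sup>+y. ennreal (\<omega> x y) \<partial>count_space UNIV) = (\<Sum>y\<in>(\<lambda>i. x + i) ` I. ennreal (\<omega> x y))"
  proof (rule nn_integral_count_space')
    fix y assume "y \<notin> (\<lambda>i. x + i) ` I"
    moreover have "y = x + (y - x)" by simp
    ultimately have "y - x \<notin> I" by (metis imageI)
    then show "ennreal (\<omega> x y) = 0" using assms(2) by (simp add: positive_env_def)
  qed (use assms in auto)
  also have "\<dots> = (\<Sum>i\<in>I. ennreal (\<omega> x (x + i)))"
    by (subst sum.reindex) (auto simp: inj_on_def)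
  also have "\<dots> = ennreal (\<Sum>i\<in>I. \<omega> x (x + i))"
    by (intro sum_ennreal positive_env_nonneg[OF assms(2)])
  finally show "(\<integral>\<^sup>+y. ennreal (\<omega> x y) \<partial>count_space UNIV) = 1"
    using assms(2) by (simp add: positive_env_def)
qed

lemma positive_env_sum_le:
  assumes "finite I" "positive_env I \<omega>" "finite F"
  shows "(\<Sum>y\<in>F. \<omega> x y) \<le> 1"
proof -
  have "(\<Sum>y\<in>F. \<omega> x y) = (\<Sum>y\<in>F. pmf (embed_pmf (\<omega> x)) y)"
    by (simp add: pmf_embed_positive_env[OF assms(1,2)])
  also have "\<dots> = measure (measure_pmf (embed_pmf (\<omega> x))) F"
    using assms(3) by (simp add: measure_measure_pmf_finite)
  finally show ?thesis by simp
qed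

lemma expected_visits_walk:
  assumes "finite I" "positive_env I \<omega>" "finite S" "x \<in> S"
  shows "(\<integral>\<^sup>+X. visits S x X \<partial>walk \<omega> z) = (\<Sum>n. ennreal (killed_prob \<omega> S z n x))"
proof -
  have "(\<lambda>y. pmf (embed_pmf (\<omega> y))) = \<omega>"
    by (intro ext pmf_embed_positive_env[OF assms(1,2)])
  then show ?thesis
    unfolding walk_def expected_visits_chain_law[OF assms(3,4)] by simp
qed

definition green :: "('a \<Rightarrow> 'a \<Rightarrow> real) \<Rightarrow> 'a set \<Rightarrow> 'a \<Rightarrow> 'a \<Rightarrow> ennreal" where
  "green \<omega> S z x = (\<Sum>n. ennreal (killed_prob \<omega> S z n x))"

text \<open>
  A finite substitute for \<open>green\<close>, which may be infinite a priori. Adding \<open>1\<close> bounds it below and makes its value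
  outside \<open>S\<close> agree with the bound on the expected number of exits through a given site. It therefore satisfies, up to a factor \<open>2\<close>
  and uniformly in \<open>N\<close>, the same one-step inequality for steps inside \<open>S\<close> and for exits.
\<close>

definition truncated_green :: "('a \<Rightarrow> 'a \<Rightarrow> real) \<Rightarrow> 'a set \<Rightarrow> 'a \<Rightarrow> nat \<Rightarrow> 'a \<Rightarrow> real" where
  "truncated_green \<omega> S z N x = (if x \<in> S then 1 + (\<Sum>n<N. killed_prob \<omega> S z n x) else 1)"

context
  fixes \<omega> :: "'a \<Rightarrow> 'a \<Rightarrow> real" and S :: "'a set" and z :: 'a
  assumes nonneg: "\<And>x y. 0 \<le> \<omega> x y"
    and sub: "\<And>x F. finite F \<Longrightarrow> (\<Sum>y\<in>F. \<omega> x y) \<le> 1"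
    and S: "finite S" "z \<in> S"
begin

lemma killed_prob_nonneg: "0 \<le> killed_prob \<omega> S z n x"
  by (induction n arbitrary: x) (auto intro!: sum_nonneg mult_nonneg_nonneg nonneg)

lemma killed_prob_step:
  assumes "x \<in> S"
  shows "killed_prob \<omega> S z n x * \<omega> x y \<le> killed_prob \<omega> S z (Suc n) y"
  unfolding killed_prob.simps using S assms
  by (intro member_le_sum[of x S "\<lambda>x. killed_prob \<omega> S z n x * \<omega> x y"]) (auto intro!: mult_nonneg_nonneg killed_prob_nonneg nonneg)

lemma killed_mass_0: "(\<Sum>x\<in>S. killed_prob \<omega> S z 0 x) = 1"
  using S by simp

lemma killed_mass_Suc:
  "(\<Sum>x\<in>S. killed_prob \<omega> S z (Suc n) x) = (\<Sum>x\<in>S. killed_prob \<omega> S z n x * (\<Sum>y\<in>S. \<omega> x y))"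
proof -
  have "(\<Sum>x\<in>S. killed_prob \<omega> S z (Suc n) x) = (\<Sum>x\<in>S. \<Sum>y\<in>S. killed_prob \<omega> S z n y * \<omega> y x)" by simp
  also have "\<dots> = (\<Sum>y\<in>S. \<Sum>x\<in>S. killed_prob \<omega> S z n y * \<omega> y x)" by (rule sum.swap)
  finally show ?thesis by (simp add: sum_distrib_left)
qed

lemma killed_mass_nonneg: "0 \<le> (\<Sum>x\<in>S. killed_prob \<omega> S z n x)"
  by (intro sum_nonneg killed_prob_nonneg)

text \<open>
  The mass that leaves \<open>S\<close> through \<open>y\<close> in one step is part of the mass that is lost in this step. Summed over \<open>n\<close>
  the right-hand side telescopes, so the total mass that exits through \<open>y\<close> is at most \<open>1\<close>.
\<close>

lemma killed_prob_exit:
  assumes "x \<in> S" "y \<notin> S"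
  shows "killed_prob \<omega> S z n x * \<omega> x y \<le> (\<Sum>x\<in>S. killed_prob \<omega> S z n x) - (\<Sum>x\<in>S. killed_prob \<omega> S z (Suc n) x)"
proof -
  have le1: "(\<Sum>y\<in>S. \<omega> u y) \<le> 1" for u using sub S by blast
  have "\<omega> x y + (\<Sum>y\<in>S. \<omega> x y) \<le> 1" using sub[of "insert y S" x] S assms by simp
  then have "killed_prob \<omega> S z n x * \<omega> x y \<le> killed_prob \<omega> S z n x * (1 - (\<Sum>y\<in>S. \<omega> x y))"
    by (intro mult_left_mono killed_prob_nonneg) simp
  also have "\<dots> \<le> (\<Sum>u\<in>S. killed_prob \<omega> S z n u * (1 - (\<Sum>y\<in>S. \<omega> u y)))"
    using S assms le1
    by (intro member_le_sum[of x S "\<lambda>u. killed_prob \<omega> S z n u * (1 - (\<Sum>y\<in>S. \<omega> u y))"])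
      (auto intro!: mult_nonneg_nonneg killed_prob_nonneg)
  also have "\<dots> = (\<Sum>x\<in>S. killed_prob \<omega> S z n x) - (\<Sum>x\<in>S. killed_prob \<omega> S z (Suc n) x)"
    unfolding killed_mass_Suc by (simp add: algebra_simps sum_subtractf)
  finally show ?thesis .
qed

lemma killed_mass_le_1: "(\<Sum>x\<in>S. killed_prob \<omega> S z n x) \<le> 1"
proof (induction n)
  case 0
  then show ?case by (simp only: killed_mass_0)
next
  case (Suc n)
  have "(\<Sum>x\<in>S. killed_prob \<omega> S z (Suc n) x) \<le> (\<Sum>x\<in>S. killed_prob \<omega> S z n x * 1)"
    unfolding killed_mass_Suc using sub S
    by (intro sum_mono mult_left_mono killed_prob_nonneg) auto
  also have "\<dots> \<le> 1" using Suc by (simp only: mult_1_right)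
  finally show ?case .
qed

lemma killed_prob_le_1: "x \<in> S \<Longrightarrow> killed_prob \<omega> S z n x \<le> 1"
  by (rule order_trans[OF member_le_sum killed_mass_le_1]) (auto intro: killed_prob_nonneg S)

lemma truncated_green_ge_1: "1 \<le> truncated_green \<omega> S z N x"
  by (auto simp: truncated_green_def intro!: sum_nonneg killed_prob_nonneg)

lemma truncated_green_step:
  assumes "x \<in> S"
  shows "truncated_green \<omega> S z N x * \<omega> x y \<le> 2 * truncated_green \<omega> S z N y"
proof -
  have w1: "\<omega> x y \<le> 1" using sub[of "{y}" x] by simp
  have e: "truncated_green \<omega> S z N x * \<omega> x y = \<omega> x y + (\<Sum>n<N. killed_prob \<omega> S z n x * \<omega> x y)"
    using assms by (simp add: truncated_green_def algebra_simps sum_distrib_left)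
  show ?thesis
  proof (cases "y \<in> S")
    case True
    have "(\<Sum>n<N. killed_prob \<omega> S z n x * \<omega> x y) \<le> (\<Sum>n<N. killed_prob \<omega> S z (Suc n) y)"
      by (intro sum_mono killed_prob_step assms)
    also have "\<dots> \<le> (\<Sum>n<Suc N. killed_prob \<omega> S z n y)"
      unfolding sum.lessThan_Suc_shift using killed_prob_nonneg[of 0 y] by linarith
    also have "\<dots> \<le> (\<Sum>n<N. killed_prob \<omega> S z n y) + 1"
      using killed_prob_le_1[OF True, of N] by simp
    finally show ?thesis using True e w1 killed_prob_nonneg
      by (simp add: truncated_green_def) (smt (verit) sum_nonneg)
  next
    case False
    let ?m = "\<lambda>n. \<Sum>x\<in>S. killed_prob \<omega> S z n x"
    have "(\<Sum>n<N. killed_prob \<omega> S z n x * \<omega> x y) \<le> (\<Sum>n<N. ?m n - ?m (Suc n))"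
      by (intro sum_mono killed_prob_exit assms False)
    also have "\<dots> = ?m 0 - ?m N" by (rule sum_lessThan_telescope')
    also have "\<dots> \<le> 1" using killed_mass_0 killed_mass_nonneg[of N] by linarith
    finally show ?thesis using e w1 False by (simp add: truncated_green_def)
  qed
qed

lemma green_step:
  assumes "x \<in> S"
  shows "ennreal (\<omega> x y) * green \<omega> S z x \<le> green \<omega> S z y"
proof -
  have "ennreal (\<omega> x y) * green \<omega> S z x = (\<Sum>n. ennreal (killed_prob \<omega> S z n x * \<omega> x y))"
    unfolding green_def ennreal_suminf_cmult[symmetric]
    by (intro suminf_cong) (simp add: ennreal_mult'[symmetric] nonneg mult.commute)
  also have "\<dots> \<le> (\<Sum>n. ennreal (killed_prob \<omega> S z (Suc n) y))"
    by (intro suminf_le ennreal_leI killed_prob_step assms) auto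
  also have "\<dots> \<le> green \<omega> S z y"
    unfolding green_def by (subst (2) suminf_offset[of _ 1]) (auto simp del: killed_prob.simps)
  finally show ?thesis .
qed

text \<open>
  If at each site of \<open>S\<close> the walk leaves with probability at most \<open>\<epsilon>\<close>, then the mass at time \<open>n\<close> is at least
  \<open>(1 - \<epsilon>) ^ n\<close>, and the expected time spent in \<open>S\<close> is at least the sum of this geometric series.
\<close>

lemma sum_green_ge:
  assumes "0 < \<epsilon>" "\<epsilon> < 1" "\<And>x. x \<in> S \<Longrightarrow> 1 - \<epsilon> \<le> (\<Sum>y\<in>S. \<omega> x y)"
  shows "ennreal (1 / \<epsilon>) \<le> (\<Sum>x\<in>S. green \<omega> S z x)"
proof -
  let ?m = "\<lambda>n. \<Sum>x\<in>S. killed_prob \<omega> S z n x"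
  have m: "(1 - \<epsilon>) ^ n \<le> ?m n" for n
  proof (induction n)
    case 0
    then show ?case using killed_mass_0 by simp
  next
    case (Suc n)
    have "(1 - \<epsilon>) ^ Suc n \<le> ?m n * (1 - \<epsilon>)" using Suc assms by simp
    also have "\<dots> \<le> (\<Sum>x\<in>S. killed_prob \<omega> S z n x * (\<Sum>y\<in>S. \<omega> x y))"
      unfolding sum_distrib_right by (intro sum_mono mult_left_mono assms killed_prob_nonneg)
    finally show ?case unfolding killed_mass_Suc .
  qed
  have "(\<Sum>n. ennreal ((1 - \<epsilon>) ^ n)) = ennreal (1 / \<epsilon>)"
    using assms geometric_sums[of "1 - \<epsilon>"] by (intro suminf_ennreal_eq) auto
  then have "ennreal (1 / \<epsilon>) = (\<Sum>n. ennreal ((1 - \<epsilon>) ^ n))" ..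
  also have "\<dots> \<le> (\<Sum>n. ennreal (?m n))"
    using m by (intro suminf_le ennreal_leI) auto
  also have "\<dots> = (\<Sum>n. \<Sum>x\<in>S. ennreal (killed_prob \<omega> S z n x))"
    by (intro suminf_cong sum_ennreal[symmetric] killed_prob_nonneg)
  also have "\<dots> = (\<Sum>x\<in>S. green \<omega> S z x)"
    unfolding green_def by (intro suminf_sum) auto
  finally show ?thesis .
qed

end


section \<open>Upper bounds on the Green function\<close>

text \<open>
  Read \<open>d x = ln (h z) - ln (h x)\<close> as a height and slice at level \<open>t\<close>: the set \<open>{x \<in> V. d x \<le> t}\<close> contains \<open>z\<close>, all of its
  exits lead to heights above \<open>t\<close>, and outside an exceptional set of levels it has no dead ends, so that its exit
  weight is at least \<open>\<kappa>\<close>. Integrated over \<open>t\<close>, an edge contributes its weight times its gain in height, which the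
  inequality for \<open>h\<close> bounds by \<open>ln (2 / \<omega>)\<close>.
\<close>

lemma coarea_bound:
  fixes h \<alpha> :: "int \<Rightarrow> real" and \<omega> :: "int \<Rightarrow> int \<Rightarrow> real" and I V :: "int set"
  assumes V: "finite V" "z \<in> V" and I: "finite I"
    and h: "\<And>x. 1 \<le> h x" "\<And>x. x \<notin> V \<Longrightarrow> h x = 1"
    and step: "\<And>x i. x \<in> V \<Longrightarrow> i \<in> I \<Longrightarrow> h x * \<omega> x (x + i) \<le> 2 * h (x + i)"
    and \<omega>: "\<And>x i. i \<in> I \<Longrightarrow> 0 < \<omega> x (x + i)" "\<And>x i. i \<in> I \<Longrightarrow> \<omega> x (x + i) \<le> 1"
    and big: "\<And>x. x \<in> V \<Longrightarrow> \<exists>i\<in>I. 1 / real (card I) \<le> \<omega> x (x + i)"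
    and \<alpha>: "\<And>i. i \<in> I \<Longrightarrow> 0 \<le> \<alpha> i" and \<kappa>0: "0 \<le> \<kappa>"
    and \<kappa>: "\<And>B. B \<subseteq> V \<Longrightarrow> B \<noteq> {} \<Longrightarrow> (\<And>x. x \<in> B \<Longrightarrow> \<exists>i\<in>I. x + i \<in> B)
        \<Longrightarrow> \<kappa> \<le> (\<Sum>x\<in>B. \<Sum>i | i \<in> I \<and> x + i \<notin> B. \<alpha> i)"
  shows "\<kappa> * (ln (h z) - real (card V) * ln (2 * real (card I)))
     \<le> (\<Sum>x\<in>V. \<Sum>i\<in>I. \<alpha> i * ln (2 / \<omega> x (x + i)))"
proof -
  define D where "D = ln (h z)"
  define d where "d x = D - ln (h x)" for x
  define l where "l = ln (2 * real (card I))"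
  have D0: "0 \<le> D" using h(1)[of z] by (simp add: D_def)
  have dout: "d x = D" if "x \<notin> V" for x using h(2)[OF that] by (simp add: d_def)
  have n0: "1 \<le> real (card I)"
  proof -
    have "I \<noteq> {}" using big[OF V(2)] by blast
    then have "card I > 0" using I by (simp add: card_gt_0_iff)
    then show ?thesis by simp
  qed
  have l0: "0 \<le> l" unfolding l_def using n0 by (intro ln_ge_zero) simp
  have hp: "0 < h x" for x using h(1)[of x] by linarith
  have dstep: "d (x + i) - d x \<le> ln (2 / \<omega> x (x + i))" if "x \<in> V" "i \<in> I" for x i
  proof -
    have "h x \<le> (2 / \<omega> x (x + i)) * h (x + i)"
      using step[OF that] \<omega>(1)[OF that(2), of x] by (simp add: field_simps)
    then have "ln (h x) \<le> ln ((2 / \<omega> x (x + i)) * h (x + i))" using hp by (subst ln_le_cancel_iff) (auto intro!: mult_pos_pos divide_pos_pos \<omega> that)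
    also have "\<dots> = ln (2 / \<omega> x (x + i)) + ln (h (x + i))"
      using hp[of "x + i"] \<omega>(1)[OF that(2), of x] by (intro ln_mult_pos) auto
    finally show ?thesis by (simp add: d_def)
  qed
  have ln0: "0 \<le> ln (2 / \<omega> x (x + i))" if "i \<in> I" for x i
    using \<omega>[OF that, of x] by (intro ln_ge_zero) (simp add: field_simps)
  \<comment> \<open>The first sum counts the weights of the edges that cross level \<open>t\<close>. The second one is positive exactly at the
    exceptional levels: for \<open>t\<close> at least \<open>d x + l\<close>, a likely step from \<open>x\<close> cannot rise above \<open>t\<close>.\<close>
  define u where "u t = (\<Sum>x\<in>V. \<Sum>i\<in>I. \<alpha> i * indicator {d x..<d (x + i)} t) + \<kappa> * (\<Sum>x\<in>V. indicator {d x..<d x + l} t)" for t :: real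
  have u_nonneg: "0 \<le> u t" for t
    unfolding u_def by (intro add_nonneg_nonneg sum_nonneg mult_nonneg_nonneg \<alpha> \<kappa>0) auto
  have level: "\<kappa> * indicator {0..<D} t \<le> u t" for t
  proof (cases "t \<in> {0..<D} \<and> (\<forall>x\<in>V. t \<notin> {d x..<d x + l})")
    case True
    define B where "B = {x \<in> V. d x \<le> t}"
    have "z \<in> B" using True V by (auto simp: B_def d_def D_def)
    moreover have "\<exists>i\<in>I. x + i \<in> B" if "x \<in> B" for x
    proof -
      have x: "x \<in> V" "d x + l \<le> t" using that True by (auto simp: B_def not_less)
      obtain i where i: "i \<in> I" "1 / real (card I) \<le> \<omega> x (x + i)" using big[OF x(1)] by blast
      have "2 / \<omega> x (x + i) \<le> 2 * real (card I)"
        using i \<omega>(1)[OF i(1), of x] n0 by (simp add: field_simps)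
      then have "ln (2 / \<omega> x (x + i)) \<le> l"
        unfolding l_def using \<omega>(1)[OF i(1), of x] n0 by (subst ln_le_cancel_iff) auto
      then have "d (x + i) \<le> t" using dstep[OF x(1) i(1)] x(2) by linarith
      moreover from this have "x + i \<in> V" using dout[of "x + i"] True by force
      ultimately show ?thesis using i(1) by (auto simp: B_def)
    qed
    ultimately have "\<kappa> \<le> (\<Sum>x\<in>B. \<Sum>i | i \<in> I \<and> x + i \<notin> B. \<alpha> i)"
      by (intro \<kappa>) (auto simp: B_def)
    also have "\<dots> \<le> (\<Sum>x\<in>B. \<Sum>i\<in>I. \<alpha> i * indicator {d x..<d (x + i)} t)"
    proof (rule sum_mono)
      fix x assume x: "x \<in> B"
      have "(\<Sum>i | i \<in> I \<and> x + i \<notin> B. \<alpha> i) = (\<Sum>i | i \<in> I \<and> x + i \<notin> B. \<alpha> i * indicator {d x..<d (x + i)} t)"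
      proof (rule sum.cong)
        fix i assume i: "i \<in> {i. i \<in> I \<and> x + i \<notin> B}"
        then have "t < d (x + i)" using dout[of "x + i"] True by (cases "x + i \<in> V") (auto simp: B_def)
        then show "\<alpha> i = \<alpha> i * indicator {d x..<d (x + i)} t" using x by (simp add: B_def)
      qed simp
      also have "\<dots> \<le> (\<Sum>i\<in>I. \<alpha> i * indicator {d x..<d (x + i)} t)"
        using I \<alpha> by (intro sum_mono2) auto
      finally show "(\<Sum>i | i \<in> I \<and> x + i \<notin> B. \<alpha> i) \<le> (\<Sum>i\<in>I. \<alpha> i * indicator {d x..<d (x + i)} t)" .
    qed
    also have "\<dots> \<le> (\<Sum>x\<in>V. \<Sum>i\<in>I. \<alpha> i * indicator {d x..<d (x + i)} t)"
      using V \<alpha> by (intro sum_mono2) (auto simp: B_def intro!: sum_nonneg)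
    also have "\<dots> \<le> u t"
      unfolding u_def using \<kappa>0 by (simp add: sum_nonneg)
    finally show ?thesis using True by simp
  next
    case False
    show ?thesis
    proof (cases "t \<in> {0..<D}")
      case True
      with False obtain x where x: "x \<in> V" "t \<in> {d x..<d x + l}" by blast
      have "indicator {d x..<d x + l} t \<le> (\<Sum>x\<in>V. indicator {d x..<d x + l} t :: real)"
        using V x by (intro member_le_sum) auto
      then have "1 \<le> (\<Sum>x\<in>V. indicator {d x..<d x + l} t :: real)" using x by simp
      then have "\<kappa> * 1 \<le> \<kappa> * (\<Sum>x\<in>V. indicator {d x..<d x + l} t)" using \<kappa>0 by (rule mult_left_mono)
      also have "\<dots> \<le> u t" unfolding u_def using \<alpha> by (simp add: sum_nonneg)
      finally show ?thesis using True by simp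
    qed (use u_nonneg in auto)
  qed
  have int: "integrable lborel (indicator {a..<b::real} :: real \<Rightarrow> real)" for a b
    by (intro integrable_real_indicator) (cases "a \<le> b"; simp)+
  have meas: "measure lborel {a..<b::real} = max 0 (b - a)" for a b
    by (cases "a \<le> b") (auto simp: measure_def)
  have int1: "integrable lborel (\<lambda>t. \<Sum>x\<in>V. \<Sum>i\<in>I. \<alpha> i * indicator {d x..<d (x + i)} t)"
    by (intro Bochner_Integration.integrable_sum integrable_mult_right int)
  have int2: "integrable lborel (\<lambda>t. \<kappa> * (\<Sum>x\<in>V. indicator {d x..<d x + l} t))"
    by (intro Bochner_Integration.integrable_sum integrable_mult_right int)
  have "\<kappa> * D = (\<integral>t. \<kappa> * indicator {0..<D} t \<partial>lborel)"
    using D0 by (simp add: meas)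
  also have "\<dots> \<le> (\<integral>t. u t \<partial>lborel)"
    unfolding u_def
    by (intro integral_mono Bochner_Integration.integrable_add int1 int2 integrable_mult_right int level[unfolded u_def])
  also have "\<dots> = (\<Sum>x\<in>V. \<Sum>i\<in>I. \<alpha> i * max 0 (d (x + i) - d x)) + \<kappa> * (\<Sum>x\<in>V. max 0 (d x + l - d x))"
    unfolding u_def Bochner_Integration.integral_add[OF int1 int2]
    by (simp add: Bochner_Integration.integral_sum Bochner_Integration.integrable_sum int meas)
  also have "\<dots> \<le> (\<Sum>x\<in>V. \<Sum>i\<in>I. \<alpha> i * ln (2 / \<omega> x (x + i))) + \<kappa> * (\<Sum>x\<in>V. l)"
    using l0 dstep ln0 \<alpha> \<kappa>0 by (intro add_mono sum_mono mult_left_mono) auto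
  finally show ?thesis by (simp add: D_def l_def algebra_simps)
qed

lemma ennreal_powr_ennreal: "0 \<le> x \<Longrightarrow> ennreal_powr (ennreal x) s = ennreal (x powr s)"
  by (simp add: ennreal_powr_def)

lemma ennreal_powr_mono:
  assumes "t \<le> t'" "0 \<le> s"
  shows "ennreal_powr t s \<le> ennreal_powr t' s"
proof (cases "t' = \<infinity>")
  case False
  then have "t' < top" by (simp add: less_top)
  moreover from this have "t \<noteq> \<infinity>" using assms by auto
  ultimately show ?thesis using assms False
    by (auto simp: ennreal_powr_def intro!: ennreal_leI powr_mono2 enn2real_mono)
qed (simp add: ennreal_powr_def)

lemma measurable_ennreal_powr [measurable]: "(\<lambda>t. ennreal_powr t s) \<in> borel_measurable borel"
  unfolding ennreal_powr_def by measurable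

lemma positive_env_le_1:
  assumes "finite I" "positive_env I \<omega>"
  shows "\<omega> x y \<le> 1"
  using positive_env_sum_le[OF assms, of "{y}" x] by simp

lemma positive_env_big_step:
  assumes "finite I" "positive_env I \<omega>"
  shows "\<exists>i\<in>I. 1 / real (card I) \<le> \<omega> x (x + i)"
proof (rule ccontr)
  assume "\<not> ?thesis"
  then have less: "\<omega> x (x + i) < 1 / real (card I)" if "i \<in> I" for i using that by force
  have s: "(\<Sum>i\<in>I. \<omega> x (x + i)) = 1" using assms by (simp add: positive_env_def)
  then have "I \<noteq> {}" by auto
  then have "(\<Sum>i\<in>I. \<omega> x (x + i)) < (\<Sum>i\<in>I. 1 / real (card I))"
    using assms less by (intro sum_strict_mono) auto
  then show False using s \<open>I \<noteq> {}\<close> assms by simp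
qed

text \<open>
  The exponential form of the co-area estimate, applied to \<open>truncated_green\<close> and passed to the limit. The terms that do
  not involve \<open>\<omega>\<close> go into the constant \<open>C\<close>, which may depend on \<open>V\<close> but not on the environment.
\<close>

lemma green_powr_bound:
  fixes \<alpha> :: "int \<Rightarrow> real"
  assumes I: "finite I" and \<alpha>: "\<And>i. i \<in> I \<Longrightarrow> 0 < \<alpha> i"
    and V: "finite V" "z \<in> V" and s: "0 < s" "s < \<kappa>"
    and \<kappa>: "\<And>B. B \<subseteq> V \<Longrightarrow> B \<noteq> {} \<Longrightarrow> (\<And>x. x \<in> B \<Longrightarrow> \<exists>i\<in>I. x + i \<in> B)
        \<Longrightarrow> \<kappa> \<le> (\<Sum>x\<in>B. \<Sum>i | i \<in> I \<and> x + i \<notin> B. \<alpha> i)"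
  shows "\<exists>C\<ge>0. \<forall>\<omega>. positive_env I \<omega> \<longrightarrow>
    ennreal_powr (green \<omega> V z z) s \<le> ennreal C * (\<Prod>x\<in>V. ennreal (\<Prod>i\<in>I. \<omega> x (x + i) powr (- (s / \<kappa> * \<alpha> i))))"
proof -
  define r where "r = s / \<kappa>"
  have \<kappa>0: "0 < \<kappa>" using s by linarith
  define c where "c = s * (real (card V) * ln (2 * real (card I))) + r * (\<Sum>x\<in>V. \<Sum>i\<in>I. \<alpha> i * ln 2)"
  have "ennreal_powr (green \<omega> V z z) s \<le> ennreal (exp c) * (\<Prod>x\<in>V. ennreal (\<Prod>i\<in>I. \<omega> x (x + i) powr (- (r * \<alpha> i))))"
    if \<omega>: "positive_env I \<omega>" for \<omega>
  proof -
    have pos: "0 < \<omega> x (x + i)" if "i \<in> I" for x i using \<omega> that by (simp add: positive_env_def)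
    have nn: "0 \<le> \<omega> x y" for x y by (rule positive_env_nonneg[OF \<omega>])
    have sub: "finite F \<Longrightarrow> (\<Sum>y\<in>F. \<omega> x y) \<le> 1" for x F by (rule positive_env_sum_le[OF I \<omega>])
    note ctx = nn sub V
    define X where "X = exp c * (\<Prod>x\<in>V. \<Prod>i\<in>I. \<omega> x (x + i) powr (- (r * \<alpha> i)))"
    have X0: "0 \<le> X" unfolding X_def by (intro mult_nonneg_nonneg prod_nonneg) auto
    have T: "truncated_green \<omega> V z N z \<le> X powr (1 / s)" for N
    proof -
      let ?T = "truncated_green \<omega> V z N"
      have T1: "1 \<le> ?T x" for x by (rule truncated_green_ge_1[OF ctx])
      have "\<kappa> * (ln (?T z) - real (card V) * ln (2 * real (card I))) \<le> (\<Sum>x\<in>V. \<Sum>i\<in>I. \<alpha> i * ln (2 / \<omega> x (x + i)))"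
      proof (rule coarea_bound[OF V I, where h = ?T])
        show "x \<notin> V \<Longrightarrow> ?T x = 1" for x by (simp add: truncated_green_def)
        show "x \<in> V \<Longrightarrow> i \<in> I \<Longrightarrow> ?T x * \<omega> x (x + i) \<le> 2 * ?T (x + i)" for x i
          by (rule truncated_green_step[OF ctx])
        show "x \<in> V \<Longrightarrow> \<exists>i\<in>I. 1 / real (card I) \<le> \<omega> x (x + i)" for x
          by (rule positive_env_big_step[OF I \<omega>])
      qed (use T1 pos positive_env_le_1[OF I \<omega>] \<alpha> \<kappa>0 \<kappa> in \<open>auto intro: less_imp_le\<close>)
      also have "\<dots> = (\<Sum>x\<in>V. \<Sum>i\<in>I. \<alpha> i * ln 2) - (\<Sum>x\<in>V. \<Sum>i\<in>I. \<alpha> i * ln (\<omega> x (x + i)))"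
      proof -
        have "\<alpha> i * ln (2 / \<omega> x (x + i)) = \<alpha> i * ln 2 - \<alpha> i * ln (\<omega> x (x + i))" if "i \<in> I" for x i
          using pos[OF that, of x] by (simp add: ln_divide_pos right_diff_distrib)
        then show ?thesis by (simp add: sum_subtractf)
      qed
      finally have "r * (\<kappa> * (ln (?T z) - real (card V) * ln (2 * real (card I))))
         \<le> r * ((\<Sum>x\<in>V. \<Sum>i\<in>I. \<alpha> i * ln 2) - (\<Sum>x\<in>V. \<Sum>i\<in>I. \<alpha> i * ln (\<omega> x (x + i))))"
        using s \<kappa>0 by (intro mult_left_mono) (auto simp: r_def)
      then have ln_le: "s * ln (?T z) \<le> c - r * (\<Sum>x\<in>V. \<Sum>i\<in>I. \<alpha> i * ln (\<omega> x (x + i)))"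
        using \<kappa>0 by (simp add: c_def r_def right_diff_distrib)
      have "?T z powr s = exp (s * ln (?T z))" using T1[of z] by (simp add: powr_def)
      also have "\<dots> \<le> exp (c - r * (\<Sum>x\<in>V. \<Sum>i\<in>I. \<alpha> i * ln (\<omega> x (x + i))))" using ln_le by simp
      also have "\<dots> = exp c * exp (\<Sum>x\<in>V. \<Sum>i\<in>I. (- (r * \<alpha> i)) * ln (\<omega> x (x + i)))"
        by (simp add: exp_add[symmetric] sum_distrib_left sum_negf mult.assoc)
      also have "\<dots> = X"
        unfolding X_def using V I pos
        by (auto simp: exp_sum powr_def less_imp_neq[THEN not_sym] intro!: prod.cong)
      finally have "(?T z powr s) powr (1 / s) \<le> X powr (1 / s)"
        using s by (intro powr_mono2) auto
      then show ?thesis using s T1[of z] by (simp add: powr_powr)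
    qed
    have "green \<omega> V z z \<le> ennreal (X powr (1 / s))"
      unfolding green_def
    proof (rule suminf_le_const)
      fix N
      have "(\<Sum>n<N. ennreal (killed_prob \<omega> V z n z)) = ennreal (\<Sum>n<N. killed_prob \<omega> V z n z)"
        by (intro sum_ennreal killed_prob_nonneg[OF ctx])
      also have "\<dots> \<le> ennreal (X powr (1 / s))"
        using T[of N] V by (intro ennreal_leI) (simp add: truncated_green_def)
      finally show "(\<Sum>n<N. ennreal (killed_prob \<omega> V z n z)) \<le> ennreal (X powr (1 / s))" .
    qed simp
    then have "ennreal_powr (green \<omega> V z z) s \<le> ennreal_powr (ennreal (X powr (1 / s))) s"
      using s by (intro ennreal_powr_mono) auto
    also have "\<dots> = ennreal X" using X0 s by (simp add: ennreal_powr_ennreal powr_powr)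
    also have "\<dots> = ennreal (exp c) * (\<Prod>x\<in>V. ennreal (\<Prod>i\<in>I. \<omega> x (x + i) powr (- (r * \<alpha> i))))"
      unfolding X_def by (subst prod_ennreal) (auto intro!: prod_nonneg ennreal_mult)
    finally show ?thesis .
  qed
  then show ?thesis unfolding r_def by (intro exI[of _ "exp c"]) auto
qed



section \<open>Transport along paths and heavy tails\<close>

text \<open>
  Along a path of \<open>k\<close> edges inside \<open>S\<close> the value of \<open>h\<close> drops at most by the factor \<open>c ^ k\<close>. The constant \<open>\<delta>\<close> comes from
  one chosen path to \<open>z\<close> for each vertex, hence it depends only on the graph and on \<open>c\<close>, not on \<open>h\<close>.
\<close>

lemma strongly_conn_transport:
  fixes c :: real
  assumes S: "finite S" "strongly_conn E S" "z \<in> S" and c: "0 < c"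
  shows "\<exists>\<delta>>0. \<forall>h :: 'a \<Rightarrow> ennreal. (\<forall>x\<in>S. \<forall>y\<in>S. (x, y) \<in> E \<longrightarrow> ennreal c * h x \<le> h y) \<longrightarrow> (\<forall>x\<in>S. ennreal \<delta> * h x \<le> h z)"
proof -
  let ?P = "\<lambda>h :: 'a \<Rightarrow> ennreal. \<forall>x\<in>S. \<forall>y\<in>S. (x, y) \<in> E \<longrightarrow> ennreal c * h x \<le> h y"
  have "\<exists>\<delta>>0. \<forall>h. ?P h \<longrightarrow> ennreal \<delta> * h x \<le> h y" if "(x, y) \<in> (E \<inter> S \<times> S)\<^sup>+" for x y
    using that
  proof (induction rule: trancl_induct)
    case (base y)
    then show ?case using c by (intro exI[of _ c]) auto
  next
    case (step y w)
    then obtain \<delta> where \<delta>: "\<delta> > 0" "\<And>h. ?P h \<Longrightarrow> ennreal \<delta> * h x \<le> h y" by blast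
    have "ennreal (c * \<delta>) * h x \<le> h w" if "?P h" for h
    proof -
      have "ennreal (c * \<delta>) * h x = ennreal c * (ennreal \<delta> * h x)"
        using c \<delta> by (simp add: ennreal_mult' mult.assoc)
      also have "\<dots> \<le> ennreal c * h y" using \<delta>(2)[OF that] by (intro mult_left_mono) auto
      also have "\<dots> \<le> h w" using that step.hyps(2) by auto
      finally show ?thesis .
    qed
    then show ?case using c \<delta>(1) by (intro exI[of _ "c * \<delta>"]) auto
  qed
  then have "\<forall>x\<in>S. \<exists>\<delta>>0. \<forall>h. ?P h \<longrightarrow> ennreal \<delta> * h x \<le> h z"
    using S(2,3) unfolding strongly_conn_def by blast
  then obtain \<delta> where \<delta>: "\<And>x. x \<in> S \<Longrightarrow> 0 < \<delta> x" "\<And>x h. x \<in> S \<Longrightarrow> ?P h \<Longrightarrow> ennreal (\<delta> x) * h x \<le> h z"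
    by metis
  define m where "m = Min (\<delta> ` S)"
  have m: "0 < m" unfolding m_def using S \<delta>(1) by (subst Min_gr_iff) auto
  have "ennreal m * h x \<le> h z" if "?P h" "x \<in> S" for h x
  proof -
    have "m \<le> \<delta> x" unfolding m_def using S that by (intro Min_le) auto
    then have "ennreal m * h x \<le> ennreal (\<delta> x) * h x" by (intro mult_right_mono ennreal_leI) auto
    also have "\<dots> \<le> h z" using \<delta>(2) that by blast
    finally show ?thesis .
  qed
  then show ?thesis using m by blast
qed

text \<open>
  For a function with finite integral, dominated convergence shows that the integral of \<open>f\<close> over \<open>{x. f x \<ge> k}\<close> tends to
  \<open>0\<close> as \<open>k\<close> grows; but on the given sets this integral is at least \<open>y * emeasure M A\<close>.
\<close>

lemma nn_integral_infinite_if_heavy_tail: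
  fixes f :: "'a \<Rightarrow> ennreal"
  assumes f [measurable]: "f \<in> borel_measurable M" and \<delta>: "0 < \<delta>"
    and tail: "\<And>k::nat. \<exists>A\<in>sets M. \<exists>y\<ge>real k. (AE x in M. x \<in> A \<longrightarrow> ennreal y \<le> f x) \<and> ennreal \<delta> \<le> ennreal y * emeasure M A"
  shows "(\<integral>\<^sup>+x. f x \<partial>M) = \<infinity>"
proof (rule ccontr)
  assume "(\<integral>\<^sup>+x. f x \<partial>M) \<noteq> \<infinity>"
  then have fin: "(\<integral>\<^sup>+x. f x \<partial>M) < \<infinity>" by (simp add: less_top)
  define u where "u k x = f x * indicator {x. of_nat k \<le> f x} x" for k :: nat and x
  have um [measurable]: "u k \<in> borel_measurable M" for k unfolding u_def[abs_def] by measurable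
  have "AE x in M. f x \<noteq> \<infinity>" using nn_integral_PInf_AE[OF f] fin by auto
  then have "AE x in M. (\<lambda>k. u k x) \<longlonglongrightarrow> 0"
  proof eventually_elim
    fix x assume "f x \<noteq> \<infinity>"
    then obtain n :: nat where n: "f x < of_nat n"
      using ennreal_Ex_less_of_nat by (metis infinity_ennreal_def less_top)
    have "u k x = 0" if "n \<le> k" for k
    proof -
      have "f x < of_nat k" using n that by (meson less_le_trans of_nat_mono)
      then show ?thesis by (simp add: u_def)
    qed
    then show "(\<lambda>k. u k x) \<longlonglongrightarrow> 0"
      by (intro tendsto_eventually) (auto simp: eventually_sequentially)
  qed
  then have "(\<lambda>k. \<integral>\<^sup>+x. u k x \<partial>M) \<longlonglongrightarrow> (\<integral>\<^sup>+x. 0 \<partial>M)"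
    using fin by (intro nn_integral_dominated_convergence[where w = f]) (auto simp: u_def indicator_def)
  then have "\<forall>\<^sub>F k in sequentially. (\<integral>\<^sup>+x. u k x \<partial>M) < ennreal \<delta>"
    using \<delta> by (intro order_tendstoD) auto
  then obtain k where k: "(\<integral>\<^sup>+x. u k x \<partial>M) < ennreal \<delta>"
    by (auto simp: eventually_sequentially)
  obtain A y where A: "A \<in> sets M" "real k \<le> y" "AE x in M. x \<in> A \<longrightarrow> ennreal y \<le> f x" "ennreal \<delta> \<le> ennreal y * emeasure M A"
    using tail[of k] by blast
  have "ennreal \<delta> \<le> (\<integral>\<^sup>+x. ennreal y * indicator A x \<partial>M)"
    using A by (simp add: nn_integral_cmult_indicator)
  also have "\<dots> \<le> (\<integral>\<^sup>+x. u k x \<partial>M)"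
  proof (rule nn_integral_mono_AE)
    have ky: "of_nat k \<le> ennreal y" using A(2) by (metis ennreal_leI ennreal_of_nat_eq_real_of_nat)
    show "AE x in M. ennreal y * indicator A x \<le> u k x"
      using A(3) by eventually_elim (use ky in \<open>auto simp: u_def indicator_def intro: order_trans\<close>)
  qed
  finally show False using k by simp
qed



section \<open>Moments in the Dirichlet environment\<close>

text \<open>
  The map under which the law of the environment is the image of a product of Dirichlet distributions.
\<close>

definition env_of :: "int set \<Rightarrow> (int \<Rightarrow> int \<Rightarrow> real) \<Rightarrow> int \<Rightarrow> int \<Rightarrow> real" where
  "env_of I v = (\<lambda>x y. if y - x \<in> I then v x (y - x) else 0)"

lemma env_of_step [simp]: "i \<in> I \<Longrightarrow> env_of I v x (x + i) = v x i"
  by (simp add: env_of_def)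

text \<open>
  The last step \<open>R\<close> is the pivot in the definition of the Dirichlet environment, so it must be an allowed step.
\<close>

locale dirichlet_model =
  fixes L R :: int and \<alpha> :: "int \<Rightarrow> real"
  assumes pivot: "R \<in> steps L R \<alpha>"
begin

abbreviation "I \<equiv> steps L R \<alpha>"

lemma steps_pos: "i \<in> I \<Longrightarrow> 0 < \<alpha> i"
  by (simp add: steps_def)

lemma card_steps_ge_1: "1 \<le> real (card I)"
proof -
  have "0 < card I" using pivot by (auto simp: card_gt_0_iff)
  then show ?thesis by simp
qed

definition rows :: "(int \<Rightarrow> int \<Rightarrow> real) measure" where
  "rows = (\<Pi>\<^sub>M x\<in>UNIV. dirichlet I R \<alpha>)"

abbreviation "env_space \<equiv> (\<Pi>\<^sub>M x\<in>(UNIV::int set). \<Pi>\<^sub>M y\<in>(UNIV::int set). (borel :: real measure))"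

sublocale P: product_prob_space "\<lambda>_::int. dirichlet I R \<alpha>" "UNIV :: int set"
  by (intro product_prob_spaceI prob_space_dirichlet pivot steps_pos) simp

lemma measurable_row_entry:
  assumes "i \<in> I"
  shows "(\<lambda>v. v x i) \<in> borel_measurable rows"
proof -
  have "(\<lambda>v. v x) \<in> measurable rows (dirichlet I R \<alpha>)"
    unfolding rows_def by (rule measurable_component_singleton) simp
  moreover have "(\<lambda>q. q i) \<in> borel_measurable (dirichlet I R \<alpha>)"
    using assms by (simp add: measurable_component_singleton cong: measurable_cong_sets)
  ultimately show ?thesis by (rule measurable_compose)
qed

lemma measurable_env_of: "env_of I \<in> measurable rows env_space"
  unfolding env_of_def
proof (rule measurable_PiM_single')
  fix x :: int
  show "(\<lambda>v y. if y - x \<in> I then v x (y - x) else 0) \<in> measurable rows (\<Pi>\<^sub>M y\<in>(UNIV::int set). (borel :: real measure))"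
  proof (rule measurable_PiM_single')
    fix y :: int
    show "(\<lambda>v. if y - x \<in> I then v x (y - x) else 0) \<in> borel_measurable rows"
      by (cases "y - x \<in> I") (auto intro: measurable_row_entry)
  qed (simp add: space_PiM)
qed (simp add: space_PiM)

lemma measurable_env_entry: "(\<lambda>\<omega>. \<omega> x y) \<in> borel_measurable env_space"
proof -
  have "(\<lambda>\<omega>. \<omega> x) \<in> measurable env_space (\<Pi>\<^sub>M y\<in>(UNIV::int set). (borel :: real measure))"
    by (rule measurable_component_singleton) simp
  moreover have "(\<lambda>q. q y) \<in> borel_measurable (\<Pi>\<^sub>M y\<in>(UNIV::int set). (borel :: real measure))"
    by (rule measurable_component_singleton) simp
  ultimately show ?thesis by (rule measurable_compose)
qed

lemma measurable_killed_prob: "(\<lambda>\<omega>. killed_prob \<omega> S z n x) \<in> borel_measurable env_space"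
  by (induction n arbitrary: x) (auto intro!: borel_measurable_sum borel_measurable_times measurable_env_entry)

lemma measurable_green: "(\<lambda>\<omega>. green \<omega> S z x) \<in> borel_measurable env_space"
  unfolding green_def using measurable_killed_prob by measurable

lemma sets_positive_env: "{\<omega> \<in> space env_space. positive_env I \<omega>} \<in> sets env_space"
proof -
  note [measurable] = measurable_env_entry
  have "countable I" by (intro countable_finite steps_finite)
  then show ?thesis unfolding positive_env_def by measurable
qed

lemma AE_rows_positive: "AE v in rows. positive_env I (env_of I v)"
proof -
  have "AE v in rows. (\<forall>i\<in>I. 0 < v x i) \<and> sum (v x) I = 1" for x
    unfolding rows_def
  proof (rule AE_PiM_component)
    show "AE q in dirichlet I R \<alpha>. (\<forall>i\<in>I. 0 < q i) \<and> sum q I = 1"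
      by (rule AE_dirichlet[OF steps_finite pivot])
  qed (auto intro: P.M.prob_space_axioms)
  then have "AE v in rows. \<forall>x. (\<forall>i\<in>I. 0 < v x i) \<and> sum (v x) I = 1"
    by (simp add: AE_all_countable)
  then show ?thesis
    by eventually_elim (auto simp: positive_env_def env_of_def)
qed

lemma dirichlet_env_eq: "dirichlet_env L R \<alpha> = distr rows env_space (env_of I)"
  unfolding dirichlet_env_def rows_def env_of_def[abs_def] ..

text \<open>
  Almost surely the walk is driven by genuine probability vectors, and its expected number of visits is the Green
  function. This replaces an integrand that is not known to be measurable by a measurable one, which can be moved to
  the product space of independent rows.
\<close>

lemma annealed_moment_eq:
  assumes "finite S" "0 \<in> S"
  shows "annealed_moment L R \<alpha> S s = (\<integral>\<^sup>+v. ennreal_powr (green (env_of I v) S 0 0) s \<partial>rows)"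
proof -
  have "AE \<omega> in dirichlet_env L R \<alpha>. positive_env I \<omega>"
    unfolding dirichlet_env_eq using AE_rows_positive
    by (subst AE_distr_iff[OF measurable_env_of sets_positive_env])
  then have "annealed_moment L R \<alpha> S s = (\<integral>\<^sup>+\<omega>. ennreal_powr (green \<omega> S 0 0) s \<partial>dirichlet_env L R \<alpha>)"
    unfolding annealed_moment_def
    by (intro nn_integral_cong_AE, eventually_elim)
      (simp add: expected_visits_walk[OF steps_finite _ assms] green_def)
  also have "\<dots> = (\<integral>\<^sup>+v. ennreal_powr (green (env_of I v) S 0 0) s \<partial>rows)"
    unfolding dirichlet_env_eq
    by (rule nn_integral_distr[OF measurable_env_of])
      (use measurable_compose[OF measurable_green measurable_ennreal_powr] in simp)
  finally show ?thesis .
qed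

lemma nn_integral_rows_prod:
  assumes V: "finite V" and g: "g \<in> borel_measurable (\<Pi>\<^sub>M i\<in>I. borel)"
  shows "(\<integral>\<^sup>+v. (\<Prod>x\<in>V. g (v x)) \<partial>rows) = (\<integral>\<^sup>+q. g q \<partial>dirichlet I R \<alpha>) ^ card V"
proof -
  have g': "g \<in> borel_measurable (dirichlet I R \<alpha>)" using g by (simp cong: measurable_cong_sets)
  have m: "(\<lambda>w. \<Prod>x\<in>V. g (w x)) \<in> borel_measurable (\<Pi>\<^sub>M x\<in>V. dirichlet I R \<alpha>)"
    by (intro borel_measurable_prod_ennreal measurable_compose[OF _ g'] measurable_component_singleton)
  have "(\<integral>\<^sup>+v. (\<Prod>x\<in>V. g (v x)) \<partial>rows) = (\<integral>\<^sup>+v. (\<Prod>x\<in>V. g (restrict v V x)) \<partial>rows)"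
    by (intro nn_integral_cong prod.cong) auto
  also have "\<dots> = (\<integral>\<^sup>+w. (\<Prod>x\<in>V. g (w x)) \<partial>distr rows (\<Pi>\<^sub>M x\<in>V. dirichlet I R \<alpha>) (\<lambda>v. restrict v V))"
    unfolding rows_def
  proof (rule nn_integral_distr[symmetric])
    show "(\<lambda>v. restrict v V) \<in> measurable (\<Pi>\<^sub>M x\<in>UNIV. dirichlet I R \<alpha>) (\<Pi>\<^sub>M x\<in>V. dirichlet I R \<alpha>)"
      by (rule measurable_restrict_subset) simp
  qed (use m in simp)
  also have "\<dots> = (\<integral>\<^sup>+w. (\<Prod>x\<in>V. g (w x)) \<partial>(\<Pi>\<^sub>M x\<in>V. dirichlet I R \<alpha>))"
    unfolding rows_def using V by (subst P.distr_PiM_restrict_finite) auto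
  also have "\<dots> = (\<Prod>x\<in>V. \<integral>\<^sup>+q. g q \<partial>dirichlet I R \<alpha>)"
    using V g' by (intro P.product_nn_integral_prod)
  finally show ?thesis by simp
qed

lemma annealed_moment_finite:
  assumes \<kappa>: "\<And>C. finite C \<Longrightarrow> strongly_conn (edges L R \<alpha>) C \<Longrightarrow> \<kappa> \<le> exit_weight L R \<alpha> C"
    and s: "0 < s" "s < \<kappa>" and V: "finite V" "0 \<in> V"
  shows "annealed_moment L R \<alpha> V s < \<infinity>"
proof -
  define r where "r = s / \<kappa>"
  have r: "r < 1" using s by (simp add: r_def)
  let ?g = "\<lambda>q. ennreal (\<Prod>i\<in>I. q i powr (- (r * \<alpha> i)))"
  have g: "?g \<in> borel_measurable (\<Pi>\<^sub>M i\<in>I. borel)"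
    using measurable_prod_powr[OF steps_finite, of "\<lambda>i. - (r * \<alpha> i)" L R \<alpha>] by simp
  have "\<kappa> \<le> (\<Sum>x\<in>B. \<Sum>i | i \<in> I \<and> x + i \<notin> B. \<alpha> i)"
    if B: "B \<subseteq> V" "B \<noteq> {}" "\<And>x. x \<in> B \<Longrightarrow> \<exists>i\<in>I. x + i \<in> B" for B
  proof -
    have fB: "finite B" using B(1) V(1) by (rule finite_subset)
    show ?thesis
      using exit_weight_lower_bound[OF \<kappa> fB B(2,3)] exit_weight_eq[OF fB] by simp
  qed
  then obtain C where C: "\<And>\<omega>. positive_env I \<omega> \<Longrightarrow> ennreal_powr (green \<omega> V 0 0) s
      \<le> ennreal C * (\<Prod>x\<in>V. ennreal (\<Prod>i\<in>I. \<omega> x (x + i) powr (- (r * \<alpha> i))))"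
    using green_powr_bound[of I \<alpha> V 0 s \<kappa>, OF steps_finite steps_pos V s] unfolding r_def by blast
  have gV: "(\<lambda>v. \<Prod>x\<in>V. ?g (v x)) \<in> borel_measurable rows"
  proof (rule borel_measurable_prod_ennreal)
    fix x
    have "(\<lambda>v. v x) \<in> measurable rows (dirichlet I R \<alpha>)"
      unfolding rows_def by (rule measurable_component_singleton) simp
    moreover have "?g \<in> borel_measurable (dirichlet I R \<alpha>)"
      using g by (simp cong: measurable_cong_sets)
    ultimately show "(\<lambda>v. ?g (v x)) \<in> borel_measurable rows"
      by (rule measurable_compose)
  qed
  have "annealed_moment L R \<alpha> V s = (\<integral>\<^sup>+v. ennreal_powr (green (env_of I v) V 0 0) s \<partial>rows)"
    by (rule annealed_moment_eq[OF V])
  also have "\<dots> \<le> (\<integral>\<^sup>+v. ennreal C * (\<Prod>x\<in>V. ?g (v x)) \<partial>rows)"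
  proof (rule nn_integral_mono_AE)
    show "AE v in rows. ennreal_powr (green (env_of I v) V 0 0) s \<le> ennreal C * (\<Prod>x\<in>V. ?g (v x))"
      using AE_rows_positive
    proof eventually_elim
      fix v assume "positive_env I (env_of I v)"
      from C[OF this] show "ennreal_powr (green (env_of I v) V 0 0) s \<le> ennreal C * (\<Prod>x\<in>V. ?g (v x))"
        by (simp cong: prod.cong)
    qed
  qed
  also have "\<dots> = ennreal C * (\<integral>\<^sup>+q. ?g q \<partial>dirichlet I R \<alpha>) ^ card V"
    using nn_integral_cmult[OF gV] nn_integral_rows_prod[OF V(1) g] by simp
  also have "\<dots> < \<infinity>"
  proof -
    have "r * \<alpha> i < \<alpha> i" if "i \<in> I" for i using r steps_pos[OF that] by simp
    then have "(\<integral>\<^sup>+q. ?g q \<partial>dirichlet I R \<alpha>) < \<infinity>"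
      using dirichlet_moment[of I R "\<lambda>i. r * \<alpha> i" \<alpha>] pivot
      by (simp add: ennreal_mult_less_top)
    then show ?thesis by (simp add: ennreal_mult_less_top power_less_top_ennreal)
  qed
  finally show ?thesis .
qed

lemma annealed_moment_infinite:
  assumes S: "finite S" "strongly_conn (edges L R \<alpha>) S" "0 \<in> S"
    and s: "0 < s" "exit_weight L R \<alpha> S \<le> s"
  shows "annealed_moment L R \<alpha> S s = \<infinity>"
proof -
  define n where "n = real (card I)"
  have n: "1 \<le> n" using card_steps_ge_1 by (simp add: n_def)
  define c where "c = 1 / (2 * n)"
  have c: "0 < c" using n by (simp add: c_def)
  define J where "J x = {i \<in> I. x + i \<in> S}" for x
  define b where "b x = sum \<alpha> (I - J x)" for x
  define Box where "Box t x = {q \<in> space (\<Pi>\<^sub>M i\<in>I. borel). (\<forall>i\<in>J x. c \<le> q i) \<and> (\<forall>i\<in>I - J x. q i \<le> t)}" for t x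
  have \<beta>: "(\<Sum>x\<in>S. b x) \<le> s"
  proof -
    have "I - J x = {i \<in> I. x + i \<notin> S}" for x by (auto simp: J_def)
    then show ?thesis using s exit_weight_eq[OF S(1), of L R \<alpha>] by (simp add: b_def)
  qed
  have J: "J x \<subseteq> I" "J x \<noteq> {}" if "x \<in> S" for x
  proof -
    have "(x, x) \<in> (edges L R \<alpha> \<inter> S \<times> S)\<^sup>+" using S(2) that by (auto simp: strongly_conn_def)
    then obtain y where y: "y \<in> S" "(x, y) \<in> edges L R \<alpha>" by (meson IntE SigmaE2 tranclD)
    then have "y - x \<in> J x" by (auto simp: J_def edges_def)
    then show "J x \<noteq> {}" by blast
  qed (auto simp: J_def)
  have BoxM: "Box t x \<in> sets (dirichlet I R \<alpha>)" for t x
  proof -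
    have "(\<lambda>q. q i) \<in> borel_measurable (\<Pi>\<^sub>M i\<in>I. borel)" if "i \<in> I" for i
      using that by (rule measurable_component_singleton)
    moreover have "finite (J x)" by (simp add: J_def)
    ultimately have "Box t x \<in> sets (\<Pi>\<^sub>M i\<in>I. borel)" unfolding Box_def
      by (intro sets.sets_Collect_conj sets.sets_Collect_finite_All borel_measurable_le) (auto simp: J_def)
    then show ?thesis by simp
  qed
  have "\<forall>x\<in>S. \<exists>\<delta>>0. \<forall>t. 0 < t \<and> t \<le> 2 * c \<longrightarrow> ennreal (\<delta> * t powr b x) \<le> emeasure (dirichlet I R \<alpha>) (Box t x)"
    using dirichlet_box[of I R \<alpha>, OF steps_finite pivot steps_pos J]
    unfolding Box_def b_def c_def n_def by blast
  then obtain \<delta> where \<delta>: "\<And>x. x \<in> S \<Longrightarrow> 0 < \<delta> x"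
    "\<And>x t. x \<in> S \<Longrightarrow> 0 < t \<Longrightarrow> t \<le> 2 * c \<Longrightarrow> ennreal (\<delta> x * t powr b x) \<le> emeasure (dirichlet I R \<alpha>) (Box t x)"
    by metis
  \<comment> \<open>The event that all exits from \<open>S\<close> have probability at most \<open>t\<close> and all steps inside \<open>S\<close> at least \<open>c\<close>.\<close>
  define A where "A t = prod_emb UNIV (\<lambda>_. dirichlet I R \<alpha>) S (PiE S (Box t))" for t
  have AM: "A t \<in> sets rows" for t
    unfolding A_def rows_def using S(1) BoxM by (intro sets_PiM_I) auto
  have prob_A: "ennreal (prod \<delta> S * t powr s) \<le> emeasure rows (A t)" if t: "0 < t" "t \<le> 2 * c" for t
  proof -
    have "2 * c \<le> 1" using n by (simp add: c_def)
    then have "prod \<delta> S * t powr s \<le> prod \<delta> S * t powr (\<Sum>x\<in>S. b x)"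
      using t \<beta> \<delta>(1) by (intro mult_left_mono powr_mono' prod_nonneg) (auto intro: less_imp_le)
    also have "\<dots> = (\<Prod>x\<in>S. \<delta> x * t powr b x)"
      using t S(1) by (simp add: powr_sum prod.distrib)
    finally have "ennreal (prod \<delta> S * t powr s) \<le> ennreal (\<Prod>x\<in>S. \<delta> x * t powr b x)" by (rule ennreal_leI)
    also have "\<dots> = (\<Prod>x\<in>S. ennreal (\<delta> x * t powr b x))"
      using \<delta>(1) by (intro prod_ennreal[symmetric]) (auto intro!: mult_nonneg_nonneg intro: less_imp_le)
    also have "\<dots> \<le> (\<Prod>x\<in>S. emeasure (dirichlet I R \<alpha>) (Box t x))"
      using \<delta>(2)[OF _ t] by (intro prod_mono_ennreal)
    also have "\<dots> = emeasure rows (A t)"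
      unfolding A_def rows_def using S(1) BoxM by (intro P.emeasure_PiM_emb[symmetric]) auto
    finally show ?thesis .
  qed
  obtain \<eta> where \<eta>: "0 < \<eta>" "\<And>h :: int \<Rightarrow> ennreal. (\<forall>x\<in>S. \<forall>y\<in>S. (x, y) \<in> edges L R \<alpha> \<longrightarrow> ennreal c * h x \<le> h y)
      \<Longrightarrow> (\<forall>x\<in>S. ennreal \<eta> * h x \<le> h 0)"
    using strongly_conn_transport[OF S c] by blast
  \<comment> \<open>At each site of \<open>S\<close> the walk exits with probability at most \<open>n * t\<close>, so it spends an expected time of at least \<open>1 / (n * t)\<close> in
    \<open>S\<close>. Some site takes a share of at least \<open>1 / card S\<close>, and a fraction \<open>\<eta>\<close> of that carries over to \<open>0\<close>.\<close>
  define D where "D = \<eta> / (n * real (card S))"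
  have cardS: "0 < real (card S)" using S by (auto simp: card_gt_0_iff)
  have D: "0 < D" unfolding D_def using \<eta>(1) n cardS by (intro divide_pos_pos mult_pos_pos) auto
  have green_ge: "ennreal (D / t) \<le> green (env_of I v) S 0 0"
    if t: "0 < t" "t < 2 * c" and v: "v \<in> A t" and pos: "positive_env I (env_of I v)" for t v
  proof -
    let ?\<omega> = "env_of I v"
    have nn: "0 \<le> ?\<omega> x y" for x y by (rule positive_env_nonneg[OF pos])
    have sub: "finite F \<Longrightarrow> (\<Sum>y\<in>F. ?\<omega> x y) \<le> 1" for x F by (rule positive_env_sum_le[OF steps_finite pos])
    note ctx = nn sub S(1,3)
    have box: "v x \<in> Box t x" if "x \<in> S" for x
      using v that by (auto simp: A_def prod_emb_def)
    have "ennreal c * green ?\<omega> S 0 x \<le> green ?\<omega> S 0 y" if xy: "x \<in> S" "y \<in> S" "(x, y) \<in> edges L R \<alpha>" for x y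
    proof -
      have "y - x \<in> J x" using xy by (simp add: J_def edges_def)
      then have "c \<le> v x (y - x)" using box[OF xy(1)] by (simp add: Box_def)
      then have "c \<le> ?\<omega> x y" using xy by (simp add: env_of_def edges_def)
      then have "ennreal c * green ?\<omega> S 0 x \<le> ennreal (?\<omega> x y) * green ?\<omega> S 0 x"
        by (intro mult_right_mono ennreal_leI) auto
      also have "\<dots> \<le> green ?\<omega> S 0 y" by (rule green_step[OF ctx xy(1)])
      finally show ?thesis .
    qed
    then have tr: "ennreal \<eta> * green ?\<omega> S 0 x \<le> green ?\<omega> S 0 0" if "x \<in> S" for x
      using \<eta>(2)[of "green ?\<omega> S 0"] that by blast
    have "1 - n * t \<le> (\<Sum>y\<in>S. ?\<omega> x y)" if x: "x \<in> S" for x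
    proof -
      have "(\<Sum>y\<in>S. ?\<omega> x y) \<ge> (\<Sum>y\<in>(\<lambda>i. x + i) ` J x. ?\<omega> x y)"
        using S(1) nn by (intro sum_mono2) (auto simp: J_def)
      also have "(\<Sum>y\<in>(\<lambda>i. x + i) ` J x. ?\<omega> x y) = (\<Sum>i\<in>J x. v x i)"
        by (subst sum.reindex) (auto simp: J_def inj_on_def)
      finally have "(\<Sum>i\<in>J x. v x i) \<le> (\<Sum>y\<in>S. ?\<omega> x y)" .
      moreover have "(\<Sum>i\<in>I. v x i) = 1" using pos by (simp add: positive_env_def)
      moreover have "(\<Sum>i\<in>I. v x i) = (\<Sum>i\<in>I - J x. v x i) + (\<Sum>i\<in>J x. v x i)"
        by (intro sum.subset_diff J(1)[OF x] steps_finite)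
      moreover have "(\<Sum>i\<in>I - J x. v x i) \<le> n * t"
      proof -
        have "(\<Sum>i\<in>I - J x. v x i) \<le> real (card (I - J x)) * t"
          using box[OF x] by (intro sum_bounded_above) (simp add: Box_def)
        also have "\<dots> \<le> n * t"
          unfolding n_def using t by (intro mult_right_mono of_nat_mono card_mono) auto
        finally show ?thesis .
      qed
      ultimately show ?thesis by linarith
    qed
    moreover have "0 < n * t" "n * t < 1" using t n by (auto simp: c_def field_simps)
    ultimately have "ennreal (1 / (n * t)) \<le> (\<Sum>x\<in>S. green ?\<omega> S 0 x)"
      by (intro sum_green_ge[OF ctx])
    then have "ennreal \<eta> * ennreal (1 / (n * t)) \<le> (\<Sum>x\<in>S. ennreal \<eta> * green ?\<omega> S 0 x)"
      unfolding sum_distrib_left[symmetric] by (intro mult_left_mono) auto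
    also have "\<dots> \<le> (\<Sum>x\<in>S. green ?\<omega> S 0 0)" by (intro sum_mono tr)
    also have "\<dots> = ennreal (real (card S)) * green ?\<omega> S 0 0"
      by (simp add: ennreal_of_nat_eq_real_of_nat)
    finally have "ennreal (1 / real (card S)) * (ennreal \<eta> * ennreal (1 / (n * t)))
       \<le> ennreal (1 / real (card S)) * (ennreal (real (card S)) * green ?\<omega> S 0 0)"
      by (intro mult_left_mono) auto
    also have "\<dots> = green ?\<omega> S 0 0"
      using cardS by (simp add: mult.assoc[symmetric] ennreal_mult'[symmetric])
    also have "ennreal (1 / real (card S)) * (ennreal \<eta> * ennreal (1 / (n * t))) = ennreal (D / t)"
      using \<eta>(1) n t cardS by (simp add: ennreal_mult'[symmetric] D_def field_simps)
    finally show ?thesis .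
  qed
  have "(\<integral>\<^sup>+v. ennreal_powr (green (env_of I v) S 0 0) s \<partial>rows) = \<infinity>"
  proof (rule nn_integral_infinite_if_heavy_tail)
    show "(\<lambda>v. ennreal_powr (green (env_of I v) S 0 0) s) \<in> borel_measurable rows"
      by (rule measurable_compose[OF measurable_env_of measurable_compose[OF measurable_green measurable_ennreal_powr]])
    show "0 < D powr s * prod \<delta> S" using D \<delta>(1) by (intro mult_pos_pos prod_pos) auto
    fix k :: nat
    \<comment> \<open>Small enough for \<open>dirichlet_box\<close>, and such that \<open>(D / t) powr s\<close> exceeds \<open>k\<close>.\<close>
    define t where "t = min c (D / (real k + 1) powr (1 / s))"
    have t: "0 < t" "t < 2 * c" using c D by (auto simp: t_def)
    have k: "real k \<le> (D / t) powr s"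
    proof -
      have "t \<le> D / (real k + 1) powr (1 / s)" by (simp add: t_def)
      then have "(real k + 1) powr (1 / s) \<le> D / t" using t D by (simp add: field_simps)
      then have "((real k + 1) powr (1 / s)) powr s \<le> (D / t) powr s" using s by (intro powr_mono2) auto
      then show ?thesis using s by (simp add: powr_powr)
    qed
    have "AE v in rows. v \<in> A t \<longrightarrow> ennreal ((D / t) powr s) \<le> ennreal_powr (green (env_of I v) S 0 0) s"
      using AE_rows_positive
    proof eventually_elim
      fix v assume "positive_env I (env_of I v)"
      then show "v \<in> A t \<longrightarrow> ennreal ((D / t) powr s) \<le> ennreal_powr (green (env_of I v) S 0 0) s"
        using green_ge[OF t] ennreal_powr_mono[of "ennreal (D / t)" _ s] D t s
        by (simp add: ennreal_powr_ennreal)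
    qed
    moreover have "ennreal (D powr s * prod \<delta> S) \<le> ennreal ((D / t) powr s) * emeasure rows (A t)"
    proof -
      have "D powr s * prod \<delta> S = (D / t) powr s * (prod \<delta> S * t powr s)"
        using t D by (simp add: powr_divide)
      then have "ennreal (D powr s * prod \<delta> S) = ennreal ((D / t) powr s) * ennreal (prod \<delta> S * t powr s)"
        by (simp only: ennreal_mult'[OF powr_ge_zero])
      also have "\<dots> \<le> ennreal ((D / t) powr s) * emeasure rows (A t)"
        using t by (intro mult_left_mono prob_A) auto
      finally show ?thesis .
    qed
    ultimately show "\<exists>A\<in>sets rows. \<exists>y\<ge>real k. (AE v in rows. v \<in> A \<longrightarrow> ennreal y \<le> ennreal_powr (green (env_of I v) S 0 0) s)
       \<and> ennreal (D powr s * prod \<delta> S) \<le> ennreal y * emeasure rows A"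
      using AM k by blast
  qed
  then show ?thesis using annealed_moment_eq[OF S(1,3)] by simp
qed

end

lemma annealed_moment_mono:
  assumes "S \<subseteq> S'" "0 \<le> s"
  shows "annealed_moment L R \<alpha> S s \<le> annealed_moment L R \<alpha> S' s"
  unfolding annealed_moment_def visits_def using assms
  by (intro nn_integral_mono ennreal_powr_mono emeasure_mono) auto



section \<open>The equivalence\<close>

theorem theorem1p4:
  fixes L R :: int and \<alpha> :: "int \<Rightarrow> real" and s :: real
  assumes "L > 0" and "R > 0"
    and "\<forall>i\<in>{-L..R}. \<alpha> i \<ge> 0"
    and "\<alpha> (- L) > 0" and "\<alpha> R > 0"
    and "Gcd {i \<in> {-L..R}. \<alpha> i > 0} = 1"
    and "s > 0"
  shows "(kappa0 L R \<alpha> \<le> ereal s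
            \<longleftrightarrow> (\<forall>\<^sub>F M :: int in at_top. annealed_moment L R \<alpha> {-M..0} s = \<infinity>))
       \<and> ((\<forall>\<^sub>F M :: int in at_top. annealed_moment L R \<alpha> {-M..0} s = \<infinity>)
            \<longleftrightarrow> (\<exists>M :: int. M \<ge> 0 \<and> annealed_moment L R \<alpha> {-M..M} s = \<infinity>))"
    (is "(?a \<longleftrightarrow> ?b) \<and> (_ \<longleftrightarrow> ?c)")
proof -
  interpret dirichlet_model L R \<alpha>
    using assms by unfold_locales (auto simp: steps_def)
  have ab: ?b if a: ?a
  proof -
    obtain S where S: "finite S" "strongly_conn (edges L R \<alpha>) S" "exit_weight L R \<alpha> S \<le> s"
      using kappa0_attained[OF a] .
    \<comment> \<open>Translating \<open>S\<close> so that its maximum is \<open>0\<close> puts it, together with the starting point \<open>0\<close> in it, inside \<open>{-M..0}\<close> for all large \<open>M\<close>.\<close>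
    define m where "m = Max S"
    define T where "T = (\<lambda>x. x + - m) ` S"
    have "S \<noteq> {}" using S(2) by (simp add: strongly_conn_def)
    then have "m \<in> S" "\<And>x. x \<in> S \<Longrightarrow> x \<le> m"
      using S(1) unfolding m_def by (auto intro: Max_in Max_ge)
    then have T: "finite T" "0 \<in> T" "\<And>x. x \<in> T \<Longrightarrow> x \<le> 0"
      using S(1) by (auto simp: T_def image_iff)
    have "annealed_moment L R \<alpha> T s = \<infinity>"
      using S T strongly_conn_translate[OF S(2), of "- m"] exit_weight_translate[OF S(1), of L R \<alpha> "- m"] \<open>s > 0\<close>
      unfolding T_def by (intro annealed_moment_infinite) auto
    moreover have "T \<subseteq> {-M..0}" if "- Min T \<le> M" for M
    proof
      fix x assume x: "x \<in> T"
      then have "Min T \<le> x" using T(1) by (intro Min_le)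
      then show "x \<in> {-M..0}" using that T(3)[OF x] by simp
    qed
    ultimately have "annealed_moment L R \<alpha> {-M..0} s = \<infinity>" if "- Min T \<le> M" for M
      using annealed_moment_mono[of T "{-M..0}" s L R \<alpha>] that \<open>s > 0\<close> by (simp add: top_unique)
    then show ?b unfolding eventually_at_top_linorder by blast
  qed
  have bc: ?c if b: ?b
  proof -
    obtain N :: int where "\<And>M. N \<le> M \<Longrightarrow> annealed_moment L R \<alpha> {-M..0} s = \<infinity>"
      using b unfolding eventually_at_top_linorder by blast
    then obtain M :: int where M: "M \<ge> 0" "annealed_moment L R \<alpha> {-M..0} s = \<infinity>"
      using that[of "max 0 N"] by simp
    have "annealed_moment L R \<alpha> {-M..0} s \<le> annealed_moment L R \<alpha> {-M..M} s"
      using M(1) \<open>s > 0\<close> by (intro annealed_moment_mono) auto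
    then show ?c using M by (auto simp: top_unique)
  qed
  have ca: ?a if c: ?c
  proof (rule ccontr)
    assume "\<not> ?a"
    then have "ereal s < kappa0 L R \<alpha>" by simp
    then obtain \<kappa> where \<kappa>: "s < \<kappa>" "ereal \<kappa> < kappa0 L R \<alpha>"
      using ereal_dense2[of "ereal s" "kappa0 L R \<alpha>"] by auto
    have "\<kappa> \<le> exit_weight L R \<alpha> C" if "finite C" "strongly_conn (edges L R \<alpha>) C" for C
    proof -
      have "kappa0 L R \<alpha> \<le> ereal (exit_weight L R \<alpha> C)"
        unfolding kappa0_def using that by (intro INF_lower) auto
      then have "ereal \<kappa> \<le> ereal (exit_weight L R \<alpha> C)" using \<kappa>(2) by (meson less_imp_le order_trans)
      then show ?thesis by simp
    qed
    then have fin: "annealed_moment L R \<alpha> {-M..M} s < \<infinity>" if "M \<ge> 0" for M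
      using \<open>s > 0\<close> \<kappa>(1) that by (intro annealed_moment_finite) auto
    obtain M where "M \<ge> 0" "annealed_moment L R \<alpha> {-M..M} s = \<infinity>" using c by blast
    then show False using fin[of M] by simp
  qed
  show ?thesis using ab bc ca by blast
qed

end
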